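(* Let $p$ be a prime, $m\in\mathbb{N}$ with $m\ge 1$, $n=p^m$, $S=\{a\in\mathbb{Z}_n \mid \gcd(a,n)=1\}$, and $\Gamma=\mathrm{Cay}(\mathbb{Z}_n,S)$. Let $v\ge 1$ be an integer and let $K_v$ be the complete graph on $v$ vertices. Then the multicone graph $K_v\bigtriangledown\Gamma$ is DS with respect to its adjacency spectrum.
   Context: For a finite group $G$ and an inverse-closed subset $H\subseteq G$ not containing the identity, $\mathrm{Cay}(G,H)$ is the simple undirected graph with vertex set $G$ in which $x,y$ are adjacent iff $x^{-1}y\in H$. Here $G=\mathbb{Z}_n$ is the additive cyclic group, so $x,y$ are adjacent iff $y-x\in S$. The join $\Gamma_1\bigtriangledown\Gamma_2$ is obtained from the disjoint union of $\Gamma_1$ and $\Gamma_2$ by joining every vertex of $\Gamma_1$ to every vertex of $\Gamma_2$; a multicone graph is the join of a complete graph and a regular graph. The adjacency spectrum of a finite simple graph is the multiset of eigenvalues of its adjacency matrix. A graph is DS (determined by its spectrum) with respect to its adjacency spectrum if every finite simple graph with the same adjacency spectrum is isomorphic to it. *)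

theory Defs
  imports
    "HOL-Algebra.Elementary_Groups"
    "Graph_Theory.Graph_Theory"
    "Jordan_Normal_Form.Char_Poly"
begin

text \<open>
  Finite simple graphs are the symmetric loop-free digraphs \<^const>\<open>pair_graph\<close>: an undirected
  edge between \<open>x\<close> and \<open>y\<close> is the pair of arcs \<open>(x, y)\<close>, \<open>(y, x)\<close>. Isomorphism of such graphs
  is \<^const>\<open>digraph_iso\<close> (of the graphs viewed as digraphs via \<^const>\<open>with_proj\<close>).
\<close>

definition complete_graph :: "nat \<Rightarrow> nat pair_pre_digraph" where
  "complete_graph v = \<lparr> pverts = {..<v}, parcs = {(x, y). x < v \<and> y < v \<and> x \<noteq> y} \<rparr>"

definition Cay :: "('a, 'c) monoid_scheme \<Rightarrow> 'a set \<Rightarrow> 'a pair_pre_digraph" where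
  "Cay G H =
    \<lparr> pverts = carrier G,
      parcs = {(x, y). x \<in> carrier G \<and> y \<in> carrier G \<and> inv\<^bsub>G\<^esub> x \<otimes>\<^bsub>G\<^esub> y \<in> H} \<rparr>"

definition graph_join ::
    "'a pair_pre_digraph \<Rightarrow> 'b pair_pre_digraph \<Rightarrow> ('a + 'b) pair_pre_digraph"
    (infixr \<open>\<nabla>\<close> 65) where
  "G1 \<nabla> G2 =
    \<lparr> pverts = pverts G1 <+> pverts G2,
      parcs = {(Inl x, Inl y) | x y. (x, y) \<in> parcs G1}
            \<union> {(Inr x, Inr y) | x y. (x, y) \<in> parcs G2}
            \<union> {(Inl x, Inr y) | x y. x \<in> pverts G1 \<and> y \<in> pverts G2}
            \<union> {(Inr y, Inl x) | x y. x \<in> pverts G1 \<and> y \<in> pverts G2} \<rparr>"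

definition adjacency_matrix :: "'a pair_pre_digraph \<Rightarrow> 'a list \<Rightarrow> complex mat" where
  "adjacency_matrix G vs =
    mat (length vs) (length vs) (\<lambda>(i, j). if (vs ! i, vs ! j) \<in> parcs G then 1 else 0)"

text \<open>
  The multiset of eigenvalues, each with its multiplicity as a root of the characteristic
  polynomial. Taking the matrix over the complex numbers guarantees that the polynomial splits, so
  that no eigenvalue is missed. The choice of the vertex enumeration is immaterial, see
  \<open>adjacency_spectrum_eq\<close> below.
\<close>

definition adjacency_spectrum :: "'a pair_pre_digraph \<Rightarrow> complex multiset" where
  "adjacency_spectrum G =
    proots (char_poly (adjacency_matrix G (SOME vs. distinct vs \<and> set vs = pverts G)))"

text \<open>
  The type argument is the vertex type of the competing graphs; as a free type variable in a
  theorem it makes the statement range over all finite simple graphs on any vertex type.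
\<close>

definition determined_by_spectrum :: "'b itself \<Rightarrow> 'a pair_pre_digraph \<Rightarrow> bool" where
  "determined_by_spectrum _ G \<longleftrightarrow>
    (\<forall>H :: 'b pair_pre_digraph. pair_graph H \<longrightarrow> adjacency_spectrum H = adjacency_spectrum G \<longrightarrow>
       digraph_iso (with_proj H) (with_proj G))"

lemma pair_graphI:
  assumes "finite (pverts G)" "parcs G \<subseteq> pverts G \<times> pverts G" "sym (parcs G)" "irrefl (parcs G)"
  shows "pair_graph G"
proof
  show "finite (parcs G)" using assms(1,2) by (meson finite_SigmaI finite_subset)
  show "symmetric (with_proj G)" using assms(3) by (simp add: symmetric_def)
qed (use assms in \<open>auto simp: irrefl_def\<close>)

lemma pair_graph_complete_graph: "pair_graph (complete_graph v)"
  by (rule pair_graphI) (auto simp: complete_graph_def sym_def irrefl_def)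

lemma complete_digraph_complete_graph: "complete_digraph v (with_proj (complete_graph v))"
  by (auto simp: complete_digraph_pair_def complete_graph_def)

lemma (in group) pair_graph_Cay:
  assumes "finite (carrier G)" "H \<subseteq> carrier G" "\<one> \<notin> H" "\<And>x. x \<in> H \<Longrightarrow> inv x \<in> H"
  shows "pair_graph (Cay G H)"
proof (rule pair_graphI)
  show "sym (parcs (Cay G H))"
  proof (rule symI)
    fix x y assume "(x, y) \<in> parcs (Cay G H)"
    hence xy: "x \<in> carrier G" "y \<in> carrier G" "inv x \<otimes> y \<in> H" by (auto simp: Cay_def)
    have "inv (inv x \<otimes> y) = inv y \<otimes> x" using xy by (simp add: inv_mult_group)
    with assms(4)[OF xy(3)] xy show "(y, x) \<in> parcs (Cay G H)" by (simp add: Cay_def)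
  qed
qed (use assms in \<open>auto simp: Cay_def irrefl_def\<close>)

lemma pair_graph_join:
  assumes "pair_graph G1" "pair_graph G2"
  shows "pair_graph (G1 \<nabla> G2)"
proof -
  interpret G1: pair_graph G1 by fact
  interpret G2: pair_graph G2 by fact
  have "sym (parcs G1)" "sym (parcs G2)"
    using G1.pair_sym_arcs G2.pair_sym_arcs by (auto simp: symmetric_def)
  thus ?thesis
    by (intro pair_graphI)
       (auto simp: graph_join_def irrefl_def sym_def
             dest: G1.wellformed' G2.wellformed' G1.pair_no_loops G2.pair_no_loops)
qed

lemma char_poly_adjacency_matrix_cong:
  assumes "distinct vs" "distinct ws" "set vs = set ws"
  shows "char_poly (adjacency_matrix G vs) = char_poly (adjacency_matrix G ws)"
proof -
  define n where "n = length vs"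
  have len: "length ws = n" using assms by (metis distinct_card n_def)
  have "\<forall>i<n. \<exists>j<n. vs ! i = ws ! j" using assms(3) len n_def by (metis in_set_conv_nth)
  then obtain f where f: "\<And>i. i < n \<Longrightarrow> f i < n \<and> vs ! i = ws ! f i" by metis
  have inj: "inj_on f {..<n}"
    by (rule inj_onI) (metis assms(1) f lessThan_iff n_def nth_eq_iff_index_eq)
  hence surj: "f ` {..<n} = {..<n}"
    by (intro endo_inj_surj) (use f in auto)
  define P where "P = mat n n (\<lambda>(i, j). if j = f i then 1 else (0 :: complex))"
  define Q where "Q = mat n n (\<lambda>(i, j). if i = f j then 1 else (0 :: complex))"
  define A where "A = adjacency_matrix G vs"
  define B where "B = adjacency_matrix G ws"
  have AB: "A \<in> carrier_mat n n" "B \<in> carrier_mat n n" "P \<in> carrier_mat n n" "Q \<in> carrier_mat n n"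
    by (auto simp: A_def B_def P_def Q_def adjacency_matrix_def n_def len)
  have PQ: "P * Q = 1\<^sub>m n"
    by (rule eq_matI)
       (use f inj in \<open>auto simp: P_def Q_def scalar_prod_def if_distrib[of "\<lambda>x. x * _"]
          cong: if_cong dest: inj_onD\<close>)
  have QP: "Q * P = 1\<^sub>m n" using mat_mult_left_right_inverse[OF AB(3,4) PQ] .
  have PB: "P * B = mat n n (\<lambda>(i, j). B $$ (f i, j))"
    by (rule eq_matI)
       (use f AB in \<open>auto simp: P_def scalar_prod_def if_distrib[of "\<lambda>x. x * _"] cong: if_cong\<close>)
  have "P * B * Q = mat n n (\<lambda>(i, j). B $$ (f i, f j))"
    unfolding PB
    by (rule eq_matI)
       (use f in \<open>auto simp: Q_def scalar_prod_def if_distrib[of "\<lambda>x. _ * x"] cong: if_cong\<close>)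
  also have "\<dots> = A"
    by (rule eq_matI) (use f in \<open>auto simp: A_def B_def adjacency_matrix_def n_def[symmetric] len\<close>)
  finally have "P * B * Q = A" .
  hence "similar_mat_wit A B P Q"
    using AB PQ QP by (intro similar_mat_witI[of _ _ n]) auto
  hence "similar_mat A B" by (auto simp: similar_mat_def)
  thus ?thesis unfolding A_def B_def by (rule char_poly_similar)
qed

lemma adjacency_spectrum_eq:
  assumes "distinct vs" "set vs = pverts G"
  shows "adjacency_spectrum G = proots (char_poly (adjacency_matrix G vs))"
proof -
  have "distinct (SOME vs. distinct vs \<and> set vs = pverts G) \<and>
        set (SOME vs. distinct vs \<and> set vs = pverts G) = pverts G"
    by (rule someI) (use assms in blast)
  thus ?thesis
    unfolding adjacency_spectrum_def
    using char_poly_adjacency_matrix_cong assms by metis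
qed

end

theory Submission
  imports Defs "Jordan_Normal_Form.Schur_Decomposition"
begin

text \<open>
  Vertices of \<open>\<Gamma>\<close> are adjacent iff they are incongruent modulo \<open>p\<close>, so the multicone graph is complete
  multipartite with \<open>v\<close> parts of size \<open>1\<close> and \<open>p\<close> parts of size \<open>q = p\<^bsup>m-1\<^esup>\<close>.

  The adjacency form of a complete multipartite graph is nonpositive on the vectors with coordinate
  sum \<open>0\<close>, so there is at most one positive eigenvalue. Conversely, a graph with at most one positive
  eigenvalue has no four vertices on which the form is positive definite on a plane; this makes
  non-adjacency transitive on the non-isolated vertices. Hence every cospectral graph is complete
  multipartite up to isolated vertices.

  If the part sizes are \<open>n\<^sub>1, \<dots>, n\<^sub>k\<close> and \<open>N = \<Prod>i. (x + n\<^sub>i)\<close>, the characteristic polynomial is, up to a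
  power of \<open>x\<close>, \<open>x N' - (k - 1) N\<close>. So the polynomials \<open>N\<close> of two cospectral graphs differ by
  \<open>c x\<^bsup>k-1\<^esup>\<close>. Suppose \<open>c \<noteq> 0\<close>. Evaluating at \<open>-1\<close> shows that the other graph has no part of size
  \<open>1\<close>; the two lowest coefficients show that its part sizes have product \<open>q\<^sup>p\<close>, so that they are
  positive powers of \<open>p\<close>, and that their reciprocals sum to \<open>v + p / q\<close>. This is too large for
  \<open>v + p\<close> such powers.
\<close>

section \<open>The spectral theorem for Hermitian matrices\<close>

lemma dim_mat_adjoint [simp]: "dim_row (mat_adjoint A) = dim_col A" "dim_col (mat_adjoint A) = dim_row A"
  by (auto simp: mat_adjoint_def)

lemma index_mat_adjoint [simp]:
  "i < dim_col A \<Longrightarrow> j < dim_row A \<Longrightarrow> mat_adjoint A $$ (i, j) = conjugate (A $$ (j, i))"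
  by (simp add: mat_adjoint_def mat_of_rows_def)

lemma mat_adjoint_carrier [simp]: "A \<in> carrier_mat n m \<Longrightarrow> mat_adjoint A \<in> carrier_mat m n"
  by (metis carrier_matD carrier_matI dim_mat_adjoint)

lemma mat_adjoint_mat_adjoint [simp]: "mat_adjoint (mat_adjoint A) = A"
  by (rule eq_matI) auto

lemma mat_adjoint_mult:
  assumes "A \<in> carrier_mat n m" "B \<in> carrier_mat m k"
  shows "mat_adjoint (A * B) = mat_adjoint B * mat_adjoint A"
  by (rule eq_matI)
     (use assms in \<open>auto simp: scalar_prod_def sum_conjugate conjugate_dist_mul mult.commute intro!: sum.cong\<close>)

lemma mat_adjoint_four_block:
  assumes "A \<in> carrier_mat n1 m1" "B \<in> carrier_mat n1 m2" "C \<in> carrier_mat n2 m1" "D \<in> carrier_mat n2 m2"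
  shows "mat_adjoint (four_block_mat A B C D) =
    four_block_mat (mat_adjoint A) (mat_adjoint C) (mat_adjoint B) (mat_adjoint D)"
  by (rule eq_matI) (use assms in auto)

text \<open>Complete \<open>v\<close> to a basis and apply Gram-Schmidt, which keeps the first
  vector; rescaling every vector to norm 1 then makes the columns orthonormal.\<close>

lemma unitary_with_first_column:
  fixes v :: "complex vec"
  assumes v: "v \<in> carrier_vec n" "v \<noteq> 0\<^sub>v n"
  obtains W c where "W \<in> carrier_mat n n" "mat_adjoint W * W = 1\<^sub>m n" "col W 0 = c \<cdot>\<^sub>v v"
proof -
  interpret cof_vec_space n "TYPE(complex)" .
  define b where "b = basis_completion v"
  define ws where "ws = gram_schmidt n b"
  from basis_completion[OF v, folded b_def]
  have dist_b: "distinct b" and indep: "\<not> lin_dep (set b)" and b: "set b \<subseteq> carrier_vec n"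
    and hdb: "hd b = v" and len_b: "length b = n" by auto
  have n: "n \<noteq> 0" using v by auto
  from hdb len_b n obtain vs where bv: "b = v # vs" by (cases b) auto
  from gram_schmidt_result[OF b dist_b indep refl, folded ws_def]
  have ws: "set ws \<subseteq> carrier_vec n" "corthogonal ws" "length ws = n" by (auto simp: len_b)
  from gram_schmidt_hd[OF v(1), of vs, folded bv] have hdws: "hd ws = v" unfolding ws_def .
  \<comment> \<open>The inverse norm of \<open>w\<close>. The product \<open>w \<bullet>c w\<close>
    is a nonnegative real number of complex type, so \<open>Re\<close> loses nothing.\<close>
  define c where "c w = complex_of_real (1 / sqrt (Re (w \<bullet>c w)))" for w :: "complex vec"
  define W where "W = mat_of_cols n (map (\<lambda>w. c w \<cdot>\<^sub>v w) ws)"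
  have W: "W \<in> carrier_mat n n" using ws by (intro carrier_matI) (simp_all add: W_def)
  have wsc: "ws ! i \<in> carrier_vec n" if "i < n" for i using ws that by auto
  have colW: "col W i = c (ws ! i) \<cdot>\<^sub>v ws ! i" if "i < n" for i
    using that wsc[OF that] ws(3) by (simp add: W_def)
  have norm: "c w * (c w * (w \<bullet>c w)) = 1" if "w \<in> carrier_vec n" "w \<bullet>c w \<noteq> 0" for w
  proof -
    have "w \<bullet>c w \<ge> 0" by (rule conjugate_square_ge_0_vec)
    hence "w \<bullet>c w = of_real (Re (w \<bullet>c w))" "Re (w \<bullet>c w) \<ge> 0"
      by (auto simp: less_eq_complex_def complex_eq_iff)
    moreover from this that have "Re (w \<bullet>c w) > 0" by (metis less_eq_real_def of_real_0)
    ultimately obtain r where r: "w \<bullet>c w = of_real r" "r > 0" by blast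
    hence "c w = of_real (1 / sqrt r)" by (simp add: c_def)
    hence "c w * (c w * (w \<bullet>c w)) = of_real (1 / sqrt r * (1 / sqrt r * r))"
      unfolding r(1) by (metis of_real_mult)
    also have "1 / sqrt r * (1 / sqrt r * r) = 1" using r(2) by (simp add: field_simps)
    finally show ?thesis by simp
  qed
  have "mat_adjoint W * W = 1\<^sub>m n"
  proof (rule eq_matI)
    fix i j assume "i < dim_row (1\<^sub>m n)" "j < dim_col (1\<^sub>m n)"
    hence ij: "i < n" "j < n" by auto
    note cc = wsc[OF ij(1)] wsc[OF ij(2)]
    have "row (mat_adjoint W) i = conjugate (col W i)"
      by (rule eq_vecI) (use W ij in auto)
    hence "(mat_adjoint W * W) $$ (i, j) = conjugate (col W i) \<bullet> col W j"
      using W ij by simp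
    also have "\<dots> = col W j \<bullet>c col W i"
      using W ij by (intro comm_scalar_prod[of _ n]) auto
    also have "\<dots> = c (ws ! j) * (c (ws ! i) * (ws ! j \<bullet>c ws ! i))"
      unfolding colW[OF ij(1)] colW[OF ij(2)] conjugate_smult_vec
      using cc by (simp add: c_def)
    also have "\<dots> = (if i = j then 1 else 0)"
      using corthogonalD[OF ws(2), of j i] ij ws(3) norm[OF cc(1)] by auto
    finally show "(mat_adjoint W * W) $$ (i, j) = 1\<^sub>m n $$ (i, j)" using ij by simp
  qed (use W in auto)
  moreover have "col W 0 = c v \<cdot>\<^sub>v v"
    using colW[of 0] n ws(3) hdws by (metis hd_conv_nth list.size(3) neq0_conv)
  ultimately show ?thesis using that W by blast
qed

text \<open>Deflation: conjugating by a unitary matrix whose first column is an eigenvector splits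
  off a 1 by 1 block, and the complementary block is again Hermitian, so induction on the dimension
  applies. That \<open>D\<close> is real is shown separately, in
  \<open>spectral_theorem\<close>.\<close>

lemma hermitian_diagonalization:
  fixes A :: "complex mat"
  assumes "A \<in> carrier_mat n n" "mat_adjoint A = A"
  shows "\<exists>P D. P \<in> carrier_mat n n \<and> D \<in> carrier_mat n n \<and> mat_adjoint P * P = 1\<^sub>m n \<and>
    diagonal_mat D \<and> A = P * D * mat_adjoint P"
  using assms
proof (induction n arbitrary: A)
  case 0
  thus ?case
    by (intro exI[of _ A]) (auto simp: diagonal_mat_def intro!: eq_matI)
next
  case (Suc n A)
  note A = Suc.prems(1)
  let ?N = "Suc n"
  obtain as where as: "char_poly A = (\<Prod>a\<leftarrow>as. [:- a, 1:])" "length as = ?N"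
    using char_poly_factorized[OF A] by auto
  then obtain e es where "as = e # es" by (cases as) auto
  hence "eigenvalue A e" by (simp add: eigenvalue_root_char_poly[OF A] as)
  then obtain x where x: "x \<in> carrier_vec ?N" "x \<noteq> 0\<^sub>v ?N" "A *\<^sub>v x = e \<cdot>\<^sub>v x"
    using A by (auto simp: eigenvalue_def eigenvector_def)
  obtain W c where W: "W \<in> carrier_mat ?N ?N" "mat_adjoint W * W = 1\<^sub>m ?N" "col W 0 = c \<cdot>\<^sub>v x"
    using unitary_with_first_column[OF x(1,2)] by blast
  define V where "V = mat_adjoint W"
  have V: "V \<in> carrier_mat ?N ?N" "V * W = 1\<^sub>m ?N" using W by (auto simp: V_def)
  have WV: "W * V = 1\<^sub>m ?N" using mat_mult_left_right_inverse[OF V(1) W(1) V(2)] .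
  define B where "B = V * A * W"
  have B: "B \<in> carrier_mat ?N ?N" using A V W by (simp add: B_def)
  have "mat_adjoint B = mat_adjoint W * (mat_adjoint A * mat_adjoint V)"
    unfolding B_def using A V W
    by (simp add: mat_adjoint_mult[of _ ?N ?N _ ?N] assoc_mult_mat[of _ ?N ?N _ ?N _ ?N] mult_carrier_mat[of _ ?N ?N _ ?N])
  also have "\<dots> = B" unfolding Suc.prems(2) B_def using A V W
    by (simp add: V_def assoc_mult_mat[of _ ?N ?N _ ?N _ ?N] mult_carrier_mat[of _ ?N ?N _ ?N])
  finally have hermB: "mat_adjoint B = B" .
  \<comment> \<open>Column 0 of \<open>W\<close> is a multiple of the eigenvector, so column 0 of
    \<open>B = V * A * W\<close> is \<open>e\<close> times column 0 of \<open>V * W\<close>, the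
    identity.\<close>
  have Ax: "A *\<^sub>v col W 0 = e \<cdot>\<^sub>v col W 0"
    unfolding W(3) using A x by (simp add: mult_mat_vec smult_smult_assoc mult.commute)
  have B0: "B $$ (i, 0) = (if i = 0 then e else 0)" if "i < ?N" for i
  proof -
    have "B $$ (i, 0) = (V * (A * W)) $$ (i, 0)"
      using A V W by (simp add: B_def assoc_mult_mat[of _ ?N ?N _ ?N _ ?N] mult_carrier_mat[of _ ?N ?N _ ?N])
    also have "\<dots> = row V i \<bullet> (A *\<^sub>v col W 0)"
      unfolding col_mult2[OF A W(1) zero_less_Suc, symmetric] using A V W that
      by (intro index_mult_mat(1)) auto
    also have "\<dots> = e * (row V i \<bullet> col W 0)"
      unfolding Ax using W(1) V(1) that by (intro scalar_prod_smult_distrib[of _ ?N] col_carrier_vec) auto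
    also have "row V i \<bullet> col W 0 = (V * W) $$ (i, 0)" using V(1) W(1) that by simp
    finally show ?thesis using that unfolding V(2) by simp
  qed
  \<comment> \<open>Hermitian symmetry carries the zeros of the first column over to the first
    row.\<close>
  have B0': "B $$ (0, i) = 0" if "i < ?N" "i \<noteq> 0" for i
    using B0[OF that(1)] index_mat_adjoint[of 0 B i] B that unfolding hermB by auto
  define B1 where "B1 = mat n n (\<lambda>(i, j). B $$ (Suc i, Suc j))"
  define E where "E = mat 1 1 (\<lambda>_. e)"
  have B1: "B1 \<in> carrier_mat n n" and E: "E \<in> carrier_mat 1 1" by (auto simp: B1_def E_def)
  have Bblock: "B = four_block_mat E (0\<^sub>m 1 n) (0\<^sub>m n 1) B1"
    by (rule eq_matI) (use B B0 B0' in \<open>auto simp: E_def B1_def\<close>)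
  have "mat_adjoint B1 = B1"
  proof (rule eq_matI)
    fix i j assume "i < dim_row B1" "j < dim_col B1"
    hence ij: "i < n" "j < n" by (auto simp: B1_def)
    have "mat_adjoint B $$ (Suc i, Suc j) = cnj (B $$ (Suc j, Suc i))"
      using B ij by simp
    thus "mat_adjoint B1 $$ (i, j) = B1 $$ (i, j)" using ij by (simp add: B1_def hermB)
  qed (auto simp: B1_def)
  from Suc.IH[OF B1 this] obtain P D where PD: "P \<in> carrier_mat n n" "D \<in> carrier_mat n n"
    "mat_adjoint P * P = 1\<^sub>m n" "diagonal_mat D" "B1 = P * D * mat_adjoint P" by auto
  define P' where "P' = four_block_mat (1\<^sub>m 1) (0\<^sub>m 1 n) (0\<^sub>m n 1) P"
  define D' where "D' = four_block_mat E (0\<^sub>m 1 n) (0\<^sub>m n 1) D"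
  have P': "P' \<in> carrier_mat ?N ?N" and D': "D' \<in> carrier_mat ?N ?N"
    using PD E by (auto simp: P'_def D'_def)
  have adj0: "mat_adjoint (0\<^sub>m a b) = (0\<^sub>m b a :: complex mat)" for a b by (rule eq_matI) auto
  have adj1: "mat_adjoint (1\<^sub>m a) = (1\<^sub>m a :: complex mat)" for a by (rule eq_matI) auto
  have adjP': "mat_adjoint P' = four_block_mat (1\<^sub>m 1) (0\<^sub>m 1 n) (0\<^sub>m n 1) (mat_adjoint P)"
    unfolding P'_def using PD(1)
    by (subst mat_adjoint_four_block[of _ 1 1 _ n _ n]) (auto simp: adj0 adj1)
  have Pu: "mat_adjoint P' * P' = 1\<^sub>m ?N"
    unfolding adjP' unfolding P'_def using PD
    by (subst mult_four_block_mat[of _ 1 1 _ n _ n _ _ 1 _ n]) auto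
  have Bd: "B = P' * D' * mat_adjoint P'"
    unfolding adjP' Bblock unfolding P'_def D'_def using PD(1,2) E
    apply (subst mult_four_block_mat[of _ 1 1 _ n _ n _ _ 1 _ n], auto)
    apply (subst mult_four_block_mat[of _ 1 1 _ n _ n _ _ 1 _ n], auto simp: PD(5))
    done
  define Q where "Q = W * P'"
  have Q: "Q \<in> carrier_mat ?N ?N" using W P' by (simp add: Q_def)
  have adjQ: "mat_adjoint Q = mat_adjoint P' * V"
    unfolding Q_def V_def using W P' by (simp add: mat_adjoint_mult)
  have "mat_adjoint Q * Q = mat_adjoint P' * (V * W) * P'"
    unfolding adjQ unfolding Q_def using V(1) W(1) P'
    by (simp add: assoc_mult_mat[of _ ?N ?N _ ?N _ ?N] mult_carrier_mat[of _ ?N ?N _ ?N])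
  hence 1: "mat_adjoint Q * Q = 1\<^sub>m ?N" using Pu P' by (simp add: V(2))
  have "Q * D' * mat_adjoint Q = W * B * V"
    unfolding adjQ unfolding Q_def Bd using V(1) W(1) P' D'
    by (simp add: assoc_mult_mat[of _ ?N ?N _ ?N _ ?N] mult_carrier_mat[of _ ?N ?N _ ?N])
  also have "\<dots> = (W * V) * A * (W * V)"
    unfolding B_def using V(1) W(1) A by (simp add: assoc_mult_mat[of _ ?N ?N _ ?N _ ?N] mult_carrier_mat[of _ ?N ?N _ ?N])
  also have "\<dots> = A" unfolding WV using A by simp
  finally have 2: "A = Q * D' * mat_adjoint Q" ..
  have "diagonal_mat D'"
    using PD(2,4) by (auto simp: diagonal_mat_def D'_def E_def)
  with Q D' 1 2 show ?case by blast
qed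

lemma diag_mat_eq_if_diagonal:
  assumes "diagonal_mat D" "D \<in> carrier_mat n n"
  shows "D = mat n n (\<lambda>(i, j). if i = j then D $$ (i, i) else 0)"
  by (rule eq_matI) (use assms in \<open>auto simp: diagonal_mat_def\<close>)

text \<open>\<open>u k\<close> is the \<open>k\<close>-th column of the diagonalizing unitary
  matrix. The coordinate form suits the computations with quadratic forms, and real
  \<open>d k\<close> have a sign.\<close>

lemma spectral_theorem:
  fixes A :: "complex mat"
  assumes A: "A \<in> carrier_mat n n" "mat_adjoint A = A"
  obtains d :: "nat \<Rightarrow> real" and u :: "nat \<Rightarrow> nat \<Rightarrow> complex" where
    "\<And>i j. i < n \<Longrightarrow> j < n \<Longrightarrow> (\<Sum>k<n. cnj (u i k) * u j k) = (if i = j then 1 else 0)"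
    "\<And>i j. i < n \<Longrightarrow> j < n \<Longrightarrow> A $$ (i, j) = (\<Sum>k<n. d k * (u k i * cnj (u k j)))"
    "char_poly A = (\<Prod>k<n. [:- complex_of_real (d k), 1:])"
proof -
  obtain P D where P: "P \<in> carrier_mat n n" "mat_adjoint P * P = 1\<^sub>m n"
    and D: "D \<in> carrier_mat n n" "diagonal_mat D" and AP: "A = P * D * mat_adjoint P"
    using hermitian_diagonalization[OF A] by blast
  have P': "P * mat_adjoint P = 1\<^sub>m n"
    using mat_mult_left_right_inverse[OF mat_adjoint_carrier[OF P(1)] P] .
  have "mat_adjoint P * A * P = (mat_adjoint P * P) * D * (mat_adjoint P * P)"
    unfolding AP using P(1) D(1) by (simp add: assoc_mult_mat[of _ n n _ n _ n] mult_carrier_mat[of _ n n _ n])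
  hence DP: "D = mat_adjoint P * A * P" using D by (simp add: P(2))
  have "mat_adjoint D = mat_adjoint P * mat_adjoint A * P"
    unfolding DP using P(1) A(1) by (simp add: mat_adjoint_mult[of _ n n _ n] assoc_mult_mat[of _ n n _ n _ n] mult_carrier_mat[of _ n n _ n])
  hence adjD: "mat_adjoint D = D" unfolding A(2) DP .
  \<comment> \<open>\<open>D\<close> is a unitary conjugate of \<open>A\<close>, hence Hermitian, so
    each diagonal entry equals its own conjugate.\<close>
  have "D $$ (i, i) = of_real (Re (D $$ (i, i)))" if "i < n" for i
    using index_mat_adjoint[of i D i] that D(1) by (simp add: adjD complex_eq_iff)
  define d where "d i = Re (D $$ (i, i))" for i
  have Dd: "D = mat n n (\<lambda>(i, j). if i = j then of_real (d i) else 0)"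
    by (subst diag_mat_eq_if_diagonal[OF D(2,1)])
       (use \<open>\<And>i. i < n \<Longrightarrow> _\<close> in \<open>auto simp: d_def intro!: eq_matI\<close>)
  show ?thesis
  proof (rule that[of "\<lambda>k i. P $$ (i, k)" d])
    fix i j assume ij: "i < n" "j < n"
    show "(\<Sum>k<n. cnj (P $$ (k, i)) * P $$ (k, j)) = (if i = j then 1 else 0)"
      using arg_cong[OF P(2), of "\<lambda>M. M $$ (i, j)"] P(1) ij
      by (simp add: scalar_prod_def lessThan_atLeast0)
    define M where "M = P * D"
    have M: "M \<in> carrier_mat n n" using P D by (simp add: M_def)
    have Mik: "M $$ (i, k) = P $$ (i, k) * d k" if "k < n" for k
      unfolding M_def Dd using that P(1) ij
      by (simp add: scalar_prod_def if_distrib[of "\<lambda>x. _ * x"] cong: if_cong)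
    have "A $$ (i, j) = row M i \<bullet> col (mat_adjoint P) j"
      unfolding AP M_def[symmetric] using M P(1) ij by (intro index_mult_mat(1)) auto
    also have "\<dots> = (\<Sum>k<n. M $$ (i, k) * cnj (P $$ (j, k)))"
      unfolding scalar_prod_def using M P(1) ij by (intro sum.cong) auto
    also have "\<dots> = (\<Sum>k<n. d k * (P $$ (i, k) * cnj (P $$ (j, k))))"
      by (intro sum.cong) (auto simp: Mik)
    finally show "A $$ (i, j) = (\<Sum>k<n. d k * (P $$ (i, k) * cnj (P $$ (j, k))))" .
  next
    have "similar_mat A D"
      unfolding similar_mat_def
      using similar_mat_witI[OF P' P(2) AP A(1) D(1) P(1) mat_adjoint_carrier[OF P(1)]] by blast
    hence "char_poly A = char_poly D" by (rule char_poly_similar)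
    also have "\<dots> = (\<Prod>a\<leftarrow>diag_mat D. [:- a, 1:])"
      using D by (intro char_poly_upper_triangular[of _ n]) (auto simp: diagonal_mat_def)
    also have "diag_mat D = map (\<lambda>i. of_real (d i)) [0..<n]"
      by (auto simp: diag_mat_def Dd)
    also have "(\<Prod>a\<leftarrow>\<dots>. [:- a, 1:]) = (\<Prod>k<n. [:- complex_of_real (d k), 1:])"
      by (simp add: prod.list_conv_set_nth lessThan_atLeast0 o_def)
    finally show "char_poly A = (\<Prod>k<n. [:- complex_of_real (d k), 1:])" .
  qed
qed

text \<open>A plane meets every hyperplane: \<open>s\<close> and \<open>t\<close> stand for the
  values of a linear functional on two vectors spanning the plane.\<close>

lemma linear_dependence_pair:
  fixes s t :: complex
  obtains \<alpha> \<beta> where "\<alpha> * s + \<beta> * t = 0" "\<alpha> \<noteq> 0 \<or> \<beta> \<noteq> 0"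
proof (cases "s = 0 \<and> t = 0")
  case True
  thus ?thesis by (intro that[of 1 0]) auto
next
  case False
  thus ?thesis by (intro that[of t "- s"]) auto
qed

text \<open>In eigencoordinates \<open>t\<close> the form is \<open>\<Sum>k. d k * |t k|^2\<close>.
  If only \<open>d k0\<close> can be positive, orthogonality to the eigenvector \<open>u k0\<close>
  removes that term. If two of the \<open>d k\<close> are positive, the plane of their eigenvectors
  meets the kernel of any \<open>w\<close> in a nonzero vector, where the form is positive.\<close>

lemma at_most_one_positive_eigenvalue_iff:
  fixes A :: "complex mat"
  assumes A: "A \<in> carrier_mat n n" "mat_adjoint A = A"
  shows "size {#z \<in># proots (char_poly A). Re z > 0#} \<le> 1 \<longleftrightarrow>
    (\<exists>w. \<forall>x. (\<Sum>i<n. w i * x i) = 0 \<longrightarrow> Re (\<Sum>i<n. \<Sum>j<n. cnj (x i) * A $$ (i, j) * x j) \<le> 0)"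
    (is "?L \<longleftrightarrow> ?R")
proof -
  obtain d :: "nat \<Rightarrow> real" and u :: "nat \<Rightarrow> nat \<Rightarrow> complex" where
    u: "\<And>i j. i < n \<Longrightarrow> j < n \<Longrightarrow> (\<Sum>k<n. cnj (u i k) * u j k) = (if i = j then 1 else 0)" and
    Au: "\<And>i j. i < n \<Longrightarrow> j < n \<Longrightarrow> A $$ (i, j) = (\<Sum>k<n. d k * (u k i * cnj (u k j)))" and
    cp: "char_poly A = (\<Prod>k<n. [:- complex_of_real (d k), 1:])"
    by (rule spectral_theorem[OF A], rule that) auto
  define J where "J = {k. k < n \<and> d k > 0}"
  have "proots (char_poly A) = (\<Sum>k<n. {#complex_of_real (d k)#})"
    unfolding cp by (subst proots_prod) auto
  also have "\<dots> = image_mset (\<lambda>k. complex_of_real (d k)) (mset_set {..<n})"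
    by (induction n) (simp_all add: lessThan_Suc)
  finally have "{#z \<in># proots (char_poly A). Re z > 0#} = image_mset (\<lambda>k. complex_of_real (d k)) (mset_set J)"
    by (simp add: filter_mset_image_mset o_def J_def)
  hence L: "?L \<longleftrightarrow> card J \<le> 1" by simp
  have finJ: "finite J" by (simp add: J_def)
  define t where "t x k = (\<Sum>i<n. cnj (u k i) * x i)" for x k
  have form: "Re (\<Sum>i<n. \<Sum>j<n. cnj (x i) * A $$ (i, j) * x j) = (\<Sum>k<n. d k * (cmod (t x k))\<^sup>2)" for x
  proof -
    have "(\<Sum>i<n. \<Sum>j<n. cnj (x i) * A $$ (i, j) * x j) =
        (\<Sum>i<n. \<Sum>j<n. \<Sum>k<n. d k * ((cnj (x i) * u k i) * (cnj (u k j) * x j)))"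
      by (intro sum.cong) (auto simp: Au sum_distrib_left sum_distrib_right mult_ac)
    also have "\<dots> = (\<Sum>i<n. \<Sum>k<n. \<Sum>j<n. d k * ((cnj (x i) * u k i) * (cnj (u k j) * x j)))"
      by (intro sum.cong refl sum.swap)
    also have "\<dots> = (\<Sum>k<n. \<Sum>i<n. \<Sum>j<n. d k * ((cnj (x i) * u k i) * (cnj (u k j) * x j)))"
      by (rule sum.swap)
    also have "\<dots> = (\<Sum>k<n. d k * (cnj (t x k) * t x k))"
      by (simp add: t_def sum_product cnj_sum sum_distrib_left mult_ac)
    also have "\<dots> = of_real (\<Sum>k<n. d k * (cmod (t x k))\<^sup>2)"
      by (simp only: of_real_sum of_real_mult complex_norm_square mult.commute)
    finally show ?thesis by (simp only: Re_complex_of_real)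
  qed
  show ?thesis unfolding L
  proof
    assume "card J \<le> 1"
    then obtain k0 where k0: "J \<subseteq> {k0}"
      using finJ by (cases "J = {}") (auto simp: card_le_Suc0_iff_eq)
    show ?R
    proof (intro exI[of _ "\<lambda>i. cnj (u k0 i)"] allI impI)
      fix x assume "(\<Sum>i<n. cnj (u k0 i) * x i) = 0"
      hence "t x k0 = 0" by (simp add: t_def)
      hence "d k * (cmod (t x k))\<^sup>2 \<le> 0" if "k < n" for k
        using k0 that by (cases "k = k0") (auto simp: J_def not_less intro!: mult_nonpos_nonneg)
      thus "Re (\<Sum>i<n. \<Sum>j<n. cnj (x i) * A $$ (i, j) * x j) \<le> 0"
        unfolding form by (intro sum_nonpos) auto
    qed
  next
    assume ?R
    then obtain w where w: "\<And>x. (\<Sum>i<n. w i * x i) = 0 \<Longrightarrow> (\<Sum>k<n. d k * (cmod (t x k))\<^sup>2) \<le> 0"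
      unfolding form by blast
    show "card J \<le> 1"
    proof (rule ccontr)
      assume "\<not> card J \<le> 1"
      then obtain a b where ab: "a \<in> J" "b \<in> J" "a \<noteq> b"
        using finJ by (auto simp: card_le_Suc0_iff_eq)
      define s where "s k = (\<Sum>i<n. w i * u k i)" for k
      obtain \<alpha> \<beta> where \<alpha>\<beta>: "\<alpha> * s a + \<beta> * s b = 0" "\<alpha> \<noteq> 0 \<or> \<beta> \<noteq> 0"
        using linear_dependence_pair .
      define x where "x i = \<alpha> * u a i + \<beta> * u b i" for i
      have "(\<Sum>i<n. w i * x i) = \<alpha> * s a + \<beta> * s b"
        by (simp add: x_def s_def sum_distrib_left algebra_simps sum.distrib)
      hence le: "(\<Sum>k<n. d k * (cmod (t x k))\<^sup>2) \<le> 0" using w \<alpha>\<beta> by simp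
      have tx: "t x k = (if k = a then \<alpha> else if k = b then \<beta> else 0)" if "k < n" for k
      proof -
        have "t x k = \<alpha> * (\<Sum>i<n. cnj (u k i) * u a i) + \<beta> * (\<Sum>i<n. cnj (u k i) * u b i)"
          by (simp add: t_def x_def sum_distrib_left algebra_simps sum.distrib)
        thus ?thesis using u[OF that] ab by (auto simp: J_def)
      qed
      have "(\<Sum>k<n. d k * (cmod (t x k))\<^sup>2) = (\<Sum>k\<in>{a, b}. d k * (cmod (t x k))\<^sup>2)"
        using ab by (intro sum.mono_neutral_right) (auto simp: J_def tx)
      also have "\<dots> = d a * (cmod \<alpha>)\<^sup>2 + d b * (cmod \<beta>)\<^sup>2"
        using ab by (simp add: tx J_def)
      also have "\<dots> > 0" using ab \<alpha>\<beta>(2)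
        by (auto simp: J_def intro: add_pos_nonneg add_nonneg_pos)
      finally show False using le by simp
    qed
  qed
qed

section \<open>Graphs with at most one positive eigenvalue\<close>

lemma pair_graph_symD: "pair_graph G \<Longrightarrow> (x, y) \<in> parcs G \<Longrightarrow> (y, x) \<in> parcs G"
proof -
  assume G: "pair_graph G" and xy: "(x, y) \<in> parcs G"
  interpret pair_graph G by fact
  show ?thesis using xy pair_sym_arcs by (auto simp: symmetric_def dest: symD)
qed

lemma pair_graph_verts:
  assumes "pair_graph G"
  shows "finite (pverts G)" "finite (parcs G)" "parcs G \<subseteq> pverts G \<times> pverts G" "(x, x) \<notin> parcs G"
proof -
  interpret pair_graph G by fact
  show "finite (pverts G)" "finite (parcs G)" by auto
  show "parcs G \<subseteq> pverts G \<times> pverts G" using wellformed' by auto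
  show "(x, x) \<notin> parcs G" using pair_no_loops[of "(x, x)"] by auto
qed

text \<open>Restates the eigenvalue criterion with sums over vertices and arcs, so that the graph
  arguments need no vertex enumeration.\<close>

lemma one_positive_eigenvalue_iff:
  fixes G :: "'a pair_pre_digraph"
  assumes G: "pair_graph G"
  shows "size {#z \<in># adjacency_spectrum G. Re z > 0#} \<le> 1 \<longleftrightarrow>
    (\<exists>w. \<forall>x. (\<Sum>a\<in>pverts G. w a * x a) = 0 \<longrightarrow> Re (\<Sum>(a, b)\<in>parcs G. cnj (x a) * x b) \<le> 0)"
    (is "_ \<longleftrightarrow> ?R")
proof -
  note fin = pair_graph_verts[OF G]
  obtain vs where vs: "distinct vs" "set vs = pverts G" using finite_distinct_list[OF fin(1)] by blast
  define n where "n = length vs"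
  define A where "A = adjacency_matrix G vs"
  have A: "A \<in> carrier_mat n n" by (simp add: A_def adjacency_matrix_def n_def)
  have adj: "mat_adjoint A = A"
    by (rule eq_matI) (use pair_graph_symD[OF G] in \<open>auto simp: A_def adjacency_matrix_def\<close>)
  have bij: "bij_betw ((!) vs) {..<n} (pverts G)"
    using bij_betw_nth[OF vs(1)] vs(2) by (simp add: n_def)
  have lin: "(\<Sum>i<n. f (vs ! i)) = (\<Sum>a\<in>pverts G. f a)" for f :: "'a \<Rightarrow> complex"
    using sum.reindex_bij_betw[OF bij] .
  have form: "(\<Sum>i<n. \<Sum>j<n. cnj (y (vs ! i)) * A $$ (i, j) * y (vs ! j)) =
      (\<Sum>(a, b)\<in>parcs G. cnj (y a) * y b)" for y :: "'a \<Rightarrow> complex"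
  proof -
    define E where "E a b = (if (a, b) \<in> parcs G then 1 else (0 :: complex))" for a b
    have "(\<Sum>i<n. \<Sum>j<n. cnj (y (vs ! i)) * A $$ (i, j) * y (vs ! j)) =
        (\<Sum>i<n. \<Sum>j<n. cnj (y (vs ! i)) * E (vs ! i) (vs ! j) * y (vs ! j))"
      by (intro sum.cong) (auto simp: A_def adjacency_matrix_def n_def E_def)
    also have "\<dots> = (\<Sum>a\<in>pverts G. \<Sum>b\<in>pverts G. cnj (y a) * E a b * y b)"
      by (simp add: lin[of "\<lambda>b. cnj (y (vs ! _)) * E (vs ! _) b * y b"]
          lin[of "\<lambda>a. \<Sum>b\<in>pverts G. cnj (y a) * E a b * y b"])
    also have "\<dots> = (\<Sum>(a, b)\<in>pverts G \<times> pverts G. cnj (y a) * E a b * y b)"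
      by (simp add: sum.cartesian_product)
    also have "\<dots> = (\<Sum>(a, b)\<in>parcs G. cnj (y a) * E a b * y b)"
      using fin by (intro sum.mono_neutral_right) (auto simp: E_def)
    also have "\<dots> = (\<Sum>(a, b)\<in>parcs G. cnj (y a) * y b)"
      by (intro sum.cong) (auto simp: E_def)
    finally show ?thesis .
  qed
  \<comment> \<open>The inverse of the enumeration transports functionals in one direction of the
    equivalence and test vectors in the other.\<close>
  define g where "g = the_inv_into {..<n} ((!) vs)"
  have g: "g (vs ! i) = i" if "i < n" for i
    using bij that by (simp add: g_def the_inv_into_f_f bij_betw_def)
  have "size {#z \<in># adjacency_spectrum G. Re z > 0#} \<le> 1 \<longleftrightarrow>
    (\<exists>w. \<forall>x. (\<Sum>i<n. w i * x i) = 0 \<longrightarrow> Re (\<Sum>i<n. \<Sum>j<n. cnj (x i) * A $$ (i, j) * x j) \<le> 0)"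
    (is "_ \<longleftrightarrow> ?M")
    unfolding adjacency_spectrum_eq[OF vs] A_def[symmetric]
    by (rule at_most_one_positive_eigenvalue_iff[OF A adj])
  also have "?M \<longleftrightarrow> ?R"
  proof
    assume ?M
    then obtain w where w: "\<And>x. (\<Sum>i<n. w i * x i) = 0 \<Longrightarrow>
        Re (\<Sum>i<n. \<Sum>j<n. cnj (x i) * A $$ (i, j) * x j) \<le> 0" by blast
    show ?R
    proof (intro exI[of _ "\<lambda>a. w (g a)"] allI impI)
      fix x assume "(\<Sum>a\<in>pverts G. w (g a) * x a) = 0"
      hence "(\<Sum>i<n. w i * x (vs ! i)) = 0"
        unfolding lin[symmetric] by (simp add: g)
      from w[OF this] show "Re (\<Sum>(a, b)\<in>parcs G. cnj (x a) * x b) \<le> 0"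
        unfolding form .
    qed
  next
    assume ?R
    then obtain w where w: "\<And>x. (\<Sum>a\<in>pverts G. w a * x a) = 0 \<Longrightarrow>
        Re (\<Sum>(a, b)\<in>parcs G. cnj (x a) * x b) \<le> 0" by blast
    show ?M
    proof (intro exI[of _ "\<lambda>i. w (vs ! i)"] allI impI)
      fix x assume "(\<Sum>i<n. w (vs ! i) * x i) = 0"
      hence "(\<Sum>a\<in>pverts G. w a * x (g a)) = 0"
        unfolding lin[symmetric] by (simp add: g)
      from w[OF this, unfolded form[symmetric]]
      show "Re (\<Sum>i<n. \<Sum>j<n. cnj (x i) * A $$ (i, j) * x j) \<le> 0"
        by (simp add: g)
    qed
  qed
  finally show ?thesis .
qed

text \<open>The vertices outside \<open>\<Union>P\<close> are isolated; they need not be absent.\<close>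

definition multipartite_parts :: "'a pair_pre_digraph \<Rightarrow> 'a set set \<Rightarrow> bool" where
  "multipartite_parts G P \<longleftrightarrow> finite (pverts G) \<and> \<Union>P \<subseteq> pverts G \<and> disjoint P \<and> {} \<notin> P \<and>
    parcs G = {(x, y). \<exists>X\<in>P. \<exists>Y\<in>P. X \<noteq> Y \<and> x \<in> X \<and> y \<in> Y}"

lemma multipartite_partsD:
  assumes "multipartite_parts G P"
  shows "finite (pverts G)" "finite P" "X \<in> P \<Longrightarrow> finite X" "X \<in> P \<Longrightarrow> X \<noteq> {}" "disjoint P"
    "\<Union>P \<subseteq> pverts G" "X \<in> P \<Longrightarrow> Y \<in> P \<Longrightarrow> x \<in> X \<Longrightarrow> y \<in> Y \<Longrightarrow> (x, y) \<in> parcs G \<longleftrightarrow> X \<noteq> Y"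
proof -
  show "finite (pverts G)" "\<Union>P \<subseteq> pverts G" "disjoint P" using assms by (auto simp: multipartite_parts_def)
  hence fU: "finite (\<Union>P)" by (metis finite_subset)
  thus "finite P" by (rule finite_UnionD)
  show "X \<in> P \<Longrightarrow> finite X" using finite_subset[OF Union_upper fU] .
  show "X \<in> P \<Longrightarrow> X \<noteq> {}" using assms by (auto simp: multipartite_parts_def)
  show "(x, y) \<in> parcs G \<longleftrightarrow> X \<noteq> Y" if "X \<in> P" "Y \<in> P" "x \<in> X" "y \<in> Y"
  proof
    assume "(x, y) \<in> parcs G"
    then obtain X' Y' where "X' \<in> P" "Y' \<in> P" "X' \<noteq> Y'" "x \<in> X'" "y \<in> Y'"
      using assms by (auto simp: multipartite_parts_def)
    with that disjointD[OF \<open>disjoint P\<close>, of X X'] disjointD[OF \<open>disjoint P\<close>, of Y Y'] show "X \<noteq> Y" by blast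
  next
    assume "X \<noteq> Y"
    with that assms show "(x, y) \<in> parcs G" unfolding multipartite_parts_def by blast
  qed
qed

lemma pair_graph_multipartite:
  assumes M: "multipartite_parts G P"
  shows "pair_graph G"
proof (rule pair_graphI)
  have arcs: "(x, y) \<in> parcs G \<longleftrightarrow> (\<exists>X\<in>P. \<exists>Y\<in>P. X \<noteq> Y \<and> x \<in> X \<and> y \<in> Y)" for x y
    using M by (simp add: multipartite_parts_def)
  show "sym (parcs G)" unfolding sym_def arcs by metis
  show "irrefl (parcs G)"
    unfolding irrefl_def using multipartite_partsD(7)[OF M] arcs by metis
  show "parcs G \<subseteq> pverts G \<times> pverts G"
    using multipartite_partsD(6)[OF M] by (intro subrelI) (auto simp: arcs)
qed (rule multipartite_partsD(1)[OF M])

text \<open>The arcs are all pairs in \<open>\<Union>P\<close> minus the squares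
  \<open>X \<times> X\<close>, so the form is the squared modulus of the total over
  \<open>\<Union>P\<close> minus the squared moduli of the totals over the parts. Taking
  \<open>w\<close> as the indicator of \<open>\<Union>P\<close> kills the only positive
  square.\<close>

lemma multipartite_one_positive_eigenvalue:
  assumes M: "multipartite_parts G P"
  shows "size {#z \<in># adjacency_spectrum G. Re z > 0#} \<le> 1"
  unfolding one_positive_eigenvalue_iff[OF pair_graph_multipartite[OF M]]
proof (intro exI[of _ "\<lambda>a. if a \<in> \<Union>P then 1 else 0"] allI impI)
  note MD = multipartite_partsD[OF M]
  fix x :: "'a \<Rightarrow> complex"
  assume "(\<Sum>a\<in>pverts G. (if a \<in> \<Union>P then 1 else 0) * x a) = 0"
  also have "(\<Sum>a\<in>pverts G. (if a \<in> \<Union>P then 1 else 0) * x a) = (\<Sum>a\<in>\<Union>P. x a)"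
    using MD(1,6) by (intro sum.mono_neutral_cong_right) auto
  finally have s: "(\<Sum>a\<in>\<Union>P. x a) = 0" .
  have fU: "finite (\<Union>P)" by (rule finite_subset[OF MD(6,1)])
  have arcs: "parcs G = (\<Union>P \<times> \<Union>P) - (\<Union>X\<in>P. X \<times> X)"
  proof (unfold set_eq_iff split_paired_All, intro allI)
    fix a b
    show "(a, b) \<in> parcs G \<longleftrightarrow> (a, b) \<in> (\<Union>P \<times> \<Union>P) - (\<Union>X\<in>P. X \<times> X)"
    proof
      assume ab: "(a, b) \<in> parcs G"
      hence "a \<in> \<Union>P" "b \<in> \<Union>P" using M by (auto simp: multipartite_parts_def)
      moreover have "\<not> (a \<in> X \<and> b \<in> X)" if "X \<in> P" for X using MD(7)[OF that that] ab by blast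
      ultimately show "(a, b) \<in> (\<Union>P \<times> \<Union>P) - (\<Union>X\<in>P. X \<times> X)" by blast
    next
      assume "(a, b) \<in> (\<Union>P \<times> \<Union>P) - (\<Union>X\<in>P. X \<times> X)"
      then obtain X Y where "X \<in> P" "Y \<in> P" "a \<in> X" "b \<in> Y" "X \<noteq> Y" by blast
      thus "(a, b) \<in> parcs G" using MD(7) by blast
    qed
  qed
  have square: "(\<Sum>(a, b)\<in>X \<times> X. cnj (x a) * x b) = of_real ((cmod (\<Sum>a\<in>X. x a))\<^sup>2)" for X
  proof -
    have "of_real ((cmod (\<Sum>a\<in>X. x a))\<^sup>2) = cnj (\<Sum>a\<in>X. x a) * (\<Sum>a\<in>X. x a)"
      by (simp only: complex_norm_square mult.commute)
    also have "\<dots> = (\<Sum>(a, b)\<in>X \<times> X. cnj (x a) * x b)"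
      by (simp add: sum_product sum.cartesian_product)
    finally show ?thesis ..
  qed
  have "(\<Sum>(a, b)\<in>parcs G. cnj (x a) * x b) =
      (\<Sum>(a, b)\<in>\<Union>P \<times> \<Union>P. cnj (x a) * x b) - (\<Sum>(a, b)\<in>(\<Union>X\<in>P. X \<times> X). cnj (x a) * x b)"
    unfolding arcs using fU by (intro sum_diff) auto
  also have "(\<Sum>(a, b)\<in>(\<Union>X\<in>P. X \<times> X). cnj (x a) * x b) = (\<Sum>X\<in>P. \<Sum>(a, b)\<in>X \<times> X. cnj (x a) * x b)"
    using MD(2,3,5) by (intro sum.UNION_disjoint) (auto simp: disjoint_def)
  also have "(\<Sum>(a, b)\<in>\<Union>P \<times> \<Union>P. cnj (x a) * x b) - \<dots> = - of_real (\<Sum>X\<in>P. (cmod (\<Sum>a\<in>X. x a))\<^sup>2)"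
    unfolding square s by simp
  finally show "Re (\<Sum>(a, b)\<in>parcs G. cnj (x a) * x b) \<le> 0"
    by (simp add: sum_nonneg del: of_real_sum)
qed

text \<open>Otherwise \<open>a c\<close> is an edge with neither end adjacent to \<open>b\<close>.
  The neighbour \<open>d\<close> of \<open>b\<close> matters: an isolated vertex is nonadjacent to
  both ends of every edge.\<close>

lemma nonadjacency_trans:
  assumes G: "pair_graph G" and one: "size {#z \<in># adjacency_spectrum G. Re z > 0#} \<le> 1"
    and bd: "(b, d) \<in> parcs G" and ab: "(a, b) \<notin> parcs G" and bc: "(b, c) \<notin> parcs G"
  shows "(a, c) \<notin> parcs G"
proof
  assume ac: "(a, c) \<in> parcs G"
  note fin = pair_graph_verts[OF G] and sym = pair_graph_symD[OF G]
  have sym_iff: "(x, y) \<in> parcs G \<longleftrightarrow> (y, x) \<in> parcs G" for x y using sym by blast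
  have dist: "a \<noteq> c" "b \<noteq> d" "a \<noteq> b" "c \<noteq> b" "d \<noteq> a" "d \<noteq> c"
    using ac bd ab bc fin(4) sym_iff[of b a] sym_iff[of c b] by auto
  have verts: "a \<in> pverts G" "b \<in> pverts G" "c \<in> pverts G" "d \<in> pverts G" using ac bd fin(3) by auto
  from one obtain w where w: "\<And>x. (\<Sum>a\<in>pverts G. w a * x a) = 0 \<Longrightarrow>
      Re (\<Sum>(a, b)\<in>parcs G. cnj (x a) * x b) \<le> 0"
    unfolding one_positive_eigenvalue_iff[OF G] by blast
  \<comment> \<open>On the span of \<open>e\<^sub>a + e\<^sub>c\<close> and \<open>e\<^sub>d + 2e\<^sub>b\<close> the adjacency form has the Gram matrix
    \<open>(2, t; t, 4)\<close>, where \<open>t \<le> 2\<close> counts the edges from \<open>d\<close> to \<open>{a, c}\<close>, so it is positive definite; the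
    weight 2 is needed only for the paw, \<open>t = 2\<close>.\<close>
  define s1 s2 where "s1 = w a + w c" and "s2 = w d + 2 * w b"
  obtain \<alpha> \<beta> where \<alpha>\<beta>: "\<alpha> * s1 + \<beta> * s2 = 0" "\<alpha> \<noteq> 0 \<or> \<beta> \<noteq> 0"
    using linear_dependence_pair .
  define x where "x y = (if y = a \<or> y = c then \<alpha> else if y = d then \<beta> else if y = b then 2 * \<beta> else 0)" for y
  define S where "S = {a, b, c, d}"
  have finS: "finite S" by (simp add: S_def)
  have x0: "x y = 0" if "y \<notin> S" for y using that by (simp add: x_def S_def)
  hence xS: "y \<in> S" if "x y \<noteq> 0" for y using that by blast
  have "(\<Sum>y\<in>pverts G. w y * x y) = (\<Sum>y\<in>S. w y * x y)"
    using fin(1) verts by (intro sum.mono_neutral_right) (simp_all add: S_def x0[unfolded S_def])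
  also have "\<dots> = \<alpha> * s1 + \<beta> * s2" using dist by (simp add: S_def x_def s1_def s2_def algebra_simps)
  finally have le: "Re (\<Sum>(a, b)\<in>parcs G. cnj (x a) * x b) \<le> 0" using w \<alpha>\<beta>(1) by simp
  define E where "E a b = (if (a, b) \<in> parcs G then 1 else (0 :: complex))" for a b
  define t where "t = (if (a, d) \<in> parcs G then 1 else 0) + (if (c, d) \<in> parcs G then 1 else (0 :: real))"
  have t: "t = 0 \<or> t = 1 \<or> t = 2" by (auto simp: t_def)
  have "(\<Sum>(y, z)\<in>parcs G. cnj (x y) * x z) = (\<Sum>(y, z)\<in>parcs G. cnj (x y) * E y z * x z)"
    by (intro sum.cong) (auto simp: E_def)
  also have "\<dots> = (\<Sum>(y, z)\<in>parcs G \<inter> S \<times> S. cnj (x y) * E y z * x z)"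
    using fin(2) by (intro sum.mono_neutral_right) (auto dest: xS)
  also have "\<dots> = (\<Sum>(y, z)\<in>S \<times> S. cnj (x y) * E y z * x z)"
    using finS by (intro sum.mono_neutral_left) (auto simp: E_def split: if_splits)
  also have "\<dots> = (\<Sum>y\<in>S. \<Sum>z\<in>S. cnj (x y) * E y z * x z)"
    by (simp add: sum.cartesian_product)
  also have "\<dots> = 2 * (cnj \<alpha> * \<alpha>) + 4 * (cnj \<beta> * \<beta>) + of_real t * (cnj \<alpha> * \<beta> + cnj \<beta> * \<alpha>)"
    using dist ac bd ab bc fin(4) sym_iff[of c a] sym_iff[of b a] sym_iff[of c b] sym_iff[of d b]
      sym_iff[of d a] sym_iff[of d c]
    by (simp add: S_def x_def E_def t_def algebra_simps)
  also have "Re \<dots> = (2 * (Re \<alpha>)\<^sup>2 + 4 * (Re \<beta>)\<^sup>2 + 2 * t * (Re \<alpha> * Re \<beta>)) +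
      (2 * (Im \<alpha>)\<^sup>2 + 4 * (Im \<beta>)\<^sup>2 + 2 * t * (Im \<alpha> * Im \<beta>))"
    by (simp add: algebra_simps power2_eq_square)
  finally have eq: "Re (\<Sum>(a, b)\<in>parcs G. cnj (x a) * x b) = \<dots>" .
  \<comment> \<open>Completing the square: setting aside \<open>y^2 / 8 + z^2\<close> leaves
    \<open>15/8 y^2 + 2 t y z + 3 z^2\<close>, and \<open>8 t^2 / 15 \<le> 32 / 15 < 3\<close> for
    \<open>t \<le> 2\<close>. The bound is applied to real and imaginary parts separately.\<close>
  have pos: "2 * y\<^sup>2 + 4 * z\<^sup>2 + 2 * t * (y * z) \<ge> y\<^sup>2 / 8 + z\<^sup>2" for y z :: real
  proof -
    have "0 \<le> (15 / 8) * (y + 8 * t * z / 15)\<^sup>2" by simp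
    also have "\<dots> = 15 / 8 * y\<^sup>2 + 2 * t * (y * z) + (8 * t\<^sup>2 / 15) * z\<^sup>2"
      by (simp add: power2_eq_square field_simps)
    also have "(8 * t\<^sup>2 / 15) * z\<^sup>2 \<le> 3 * z\<^sup>2" using t by (intro mult_right_mono) auto
    finally show ?thesis by simp
  qed
  have "0 < (Re \<alpha>)\<^sup>2 / 8 + (Re \<beta>)\<^sup>2 + ((Im \<alpha>)\<^sup>2 / 8 + (Im \<beta>)\<^sup>2)"
  proof -
    have "0 < (cmod \<alpha>)\<^sup>2 / 8 + (cmod \<beta>)\<^sup>2" using \<alpha>\<beta>(2) by (auto intro: add_pos_nonneg add_nonneg_pos)
    thus ?thesis by (simp add: cmod_power2 add_divide_distrib)
  qed
  with pos[of "Re \<alpha>" "Re \<beta>"] pos[of "Im \<alpha>" "Im \<beta>"] le eq show False by linarith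
qed

text \<open>The parts are the classes of non-adjacency on the non-isolated vertices
  \<open>N\<close>. A single class would carry no arcs although its vertices have neighbours;
  excluding it later keeps the constant coefficient of \<open>multipartite_poly\<close>
  nonzero.\<close>

lemma multipartite_parts_if_one_positive_eigenvalue:
  assumes G: "pair_graph G" and one: "size {#z \<in># adjacency_spectrum G. Re z > 0#} \<le> 1"
  obtains P where "multipartite_parts G P" "card P \<noteq> 1"
proof -
  note fin = pair_graph_verts[OF G] and sym = pair_graph_symD[OF G]
  define N where "N = {a. \<exists>b. (a, b) \<in> parcs G}"
  define R where "R = {(a, b). a \<in> N \<and> b \<in> N \<and> (a, b) \<notin> parcs G}"
  have "equiv N R"
  proof (rule equivI)
    show "R \<subseteq> N \<times> N" by (auto simp: R_def)
    show "refl_on N R" using fin(4) by (auto simp: refl_on_def R_def)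
    show "sym R" using sym by (auto simp: sym_def R_def)
    show "trans R"
    proof (rule transI)
      fix a b c assume ab: "(a, b) \<in> R" and bc: "(b, c) \<in> R"
      then obtain d where d: "(b, d) \<in> parcs G" by (auto simp: R_def N_def)
      show "(a, c) \<in> R" using nonadjacency_trans[OF G one d, of a c] ab bc by (simp add: R_def)
    qed
  qed
  have RI: "(a, b) \<in> parcs G \<longleftrightarrow> a \<in> N \<and> b \<in> N \<and> (a, b) \<notin> R" for a b
    using sym unfolding R_def N_def by blast
  have N: "N \<subseteq> pverts G" using fin(3) by (auto simp: N_def)
  have M: "multipartite_parts G (N // R)"
    unfolding multipartite_parts_def
  proof (intro conjI)
    show "\<Union>(N // R) \<subseteq> pverts G" using Union_quotient[OF \<open>equiv N R\<close>] N by simp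
    show "disjoint (N // R)" using quotient_disj[OF \<open>equiv N R\<close>] by (auto simp: disjoint_def)
    show "{} \<notin> N // R" using in_quotient_imp_non_empty[OF \<open>equiv N R\<close>] by blast
    show "parcs G = {(x, y). \<exists>X\<in>N // R. \<exists>Y\<in>N // R. X \<noteq> Y \<and> x \<in> X \<and> y \<in> Y}"
    proof (intro equalityI subrelI)
      fix x y
      assume "(x, y) \<in> parcs G"
      hence xy: "x \<in> N" "y \<in> N" "(x, y) \<notin> R" using RI by auto
      hence "R `` {x} \<noteq> R `` {y}" using eq_equiv_class_iff[OF \<open>equiv N R\<close>] by blast
      moreover have "x \<in> R `` {x}" "y \<in> R `` {y}"
        using equiv_class_self[OF \<open>equiv N R\<close>] xy by auto
      moreover have "R `` {x} \<in> N // R" "R `` {y} \<in> N // R" using xy by (auto intro: quotientI)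
      ultimately have "\<exists>X\<in>N // R. \<exists>Y\<in>N // R. X \<noteq> Y \<and> x \<in> X \<and> y \<in> Y"
        by (intro bexI[of _ "R `` {x}"] bexI[of _ "R `` {y}"] conjI)
      thus "(x, y) \<in> {(x, y). \<exists>X\<in>N // R. \<exists>Y\<in>N // R. X \<noteq> Y \<and> x \<in> X \<and> y \<in> Y}" by simp
    next
      fix x y
      assume "(x, y) \<in> {(x, y). \<exists>X\<in>N // R. \<exists>Y\<in>N // R. X \<noteq> Y \<and> x \<in> X \<and> y \<in> Y}"
      then obtain X Y where XY: "X \<in> N // R" "Y \<in> N // R" "X \<noteq> Y" "x \<in> X" "y \<in> Y" by auto
      hence "(x, y) \<notin> R" using quotient_eqI[OF \<open>equiv N R\<close>, of X Y x y] by blast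
      moreover have "x \<in> N" "y \<in> N" using XY Union_quotient[OF \<open>equiv N R\<close>] by blast+
      ultimately show "(x, y) \<in> parcs G" using RI by blast
    qed
  qed (use fin in auto)
  have "card (N // R) \<noteq> 1"
  proof
    assume "card (N // R) = 1"
    then obtain X where X: "N // R = {X}" by (auto simp: card_1_singleton_iff)
    then obtain x where "x \<in> N" by (fastforce simp: quotient_def)
    then obtain y where "(x, y) \<in> parcs G" by (auto simp: N_def)
    then obtain X Y where "X \<in> N // R" "Y \<in> N // R" "X \<noteq> Y"
      using M by (auto simp: multipartite_parts_def)
    with X show False by simp
  qed
  with M that show ?thesis by blast
qed

section \<open>The characteristic polynomial of a complete multipartite graph\<close>

text \<open>Sylvester's determinant identity. Column operations by the unitriangular
  \<open>L\<close> and \<open>R\<close> clear one or the other off-diagonal block of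
  \<open>M\<close>, so both sides equal \<open>det M\<close>.\<close>

lemma det_one_minus_mult_comm:
  fixes U W :: "'a :: idom mat"
  assumes U: "U \<in> carrier_mat n k" and W: "W \<in> carrier_mat k n"
  shows "det (1\<^sub>m n - U * W) = det (1\<^sub>m k - W * U)"
proof -
  define M where "M = four_block_mat (1\<^sub>m n) U W (1\<^sub>m k)"
  define L where "L = four_block_mat (1\<^sub>m n) (0\<^sub>m n k) (- W) (1\<^sub>m k)"
  define R where "R = four_block_mat (1\<^sub>m n) (- U) (0\<^sub>m k n) (1\<^sub>m k)"
  have carr: "M \<in> carrier_mat (n + k) (n + k)" "L \<in> carrier_mat (n + k) (n + k)" "R \<in> carrier_mat (n + k) (n + k)"
    using U W by (auto simp: M_def L_def R_def)
  have UW: "1\<^sub>m n - U * W \<in> carrier_mat n n" and WU: "1\<^sub>m k - W * U \<in> carrier_mat k k"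
    using mult_carrier_mat[OF U W] mult_carrier_mat[OF W U] by (auto intro: minus_carrier_mat)
  have "M * L = four_block_mat (1\<^sub>m n - U * W) U (0\<^sub>m k n) (1\<^sub>m k)"
    unfolding M_def L_def using U W
    by (subst mult_four_block_mat[of _ n n _ k _ k _ _ n _ k]) (auto intro!: arg_cong4[of _ _ _ _ _ _ _ _ four_block_mat] simp: minus_add_uminus_mat[of _ n n])
  hence "det (M * L) = det (1\<^sub>m n - U * W)"
    using det_four_block_mat_lower_left_zero[OF UW U refl one_carrier_mat] by simp
  moreover have "det L = 1"
    unfolding L_def using W by (subst det_four_block_mat_upper_right_zero[of _ n _ k]) auto
  moreover have "M * R = four_block_mat (1\<^sub>m n) (0\<^sub>m n k) W (1\<^sub>m k - W * U)"
    unfolding M_def R_def using U W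
    by (subst mult_four_block_mat[of _ n n _ k _ k _ _ n _ k]) (auto intro!: arg_cong4[of _ _ _ _ _ _ _ _ four_block_mat] simp: minus_add_uminus_mat[of _ k k] comm_add_mat)
  hence "det (M * R) = det (1\<^sub>m k - W * U)"
    using det_four_block_mat_upper_right_zero[OF one_carrier_mat refl W WU] by simp
  moreover have "det R = 1"
    unfolding R_def using U by (subst det_four_block_mat_lower_left_zero[of _ n _ k]) auto
  ultimately show ?thesis
    using det_mult[OF carr(1,2)] det_mult[OF carr(1,3)] by simp
qed

lemma det_diagonal:
  "det (mat n n (\<lambda>(i, j). if i = j then f i else 0)) = (\<Prod>i<n. f i :: 'a :: idom)"
proof -
  have "det (mat n n (\<lambda>(i, j). if i = j then f i else 0)) = prod_list (diag_mat (mat n n (\<lambda>(i, j). if i = j then f i else 0)))"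
    by (rule det_upper_triangular[of _ n]) auto
  also have "diag_mat (mat n n (\<lambda>(i, j). if i = j then f i else 0)) = map f [0..<n]"
    by (auto simp: diag_mat_def)
  finally show ?thesis by (simp add: prod.list_conv_set_nth lessThan_atLeast0)
qed

text \<open>Matrix determinant lemma. Dividing column \<open>j\<close> by \<open>f j\<close> leaves
  the identity minus a column times a row, which \<open>det_one_minus_mult_comm\<close> reduces to a
  1 by 1 determinant.\<close>

lemma det_diagonal_minus_rank_one:
  fixes f g :: "nat \<Rightarrow> 'a :: field"
  assumes "\<And>i. i < k \<Longrightarrow> f i \<noteq> 0"
  shows "det (mat k k (\<lambda>(i, j). (if i = j then f i else 0) - g j)) = (\<Prod>i<k. f i) * (1 - (\<Sum>i<k. g i / f i))"
proof -
  define U where "U = mat k 1 (\<lambda>_. 1 :: 'a)"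
  define W where "W = mat 1 k (\<lambda>(i, j). g j / f j)"
  define F where "F = mat k k (\<lambda>(i, j). if i = j then f i else 0)"
  have UW: "U \<in> carrier_mat k 1" "W \<in> carrier_mat 1 k" "F \<in> carrier_mat k k"
    by (auto simp: U_def W_def F_def)
  have IUW: "1\<^sub>m k - U * W = mat k k (\<lambda>(i, j). (if i = j then 1 else 0) - g j / f j)"
    by (rule eq_matI) (auto simp: U_def W_def scalar_prod_def)
  have "mat k k (\<lambda>(i, j). (if i = j then f i else 0) - g j) = (1\<^sub>m k - U * W) * F"
    unfolding IUW using assms
    by (intro eq_matI) (auto simp: F_def scalar_prod_def if_distrib[of "\<lambda>x. _ * x"] left_diff_distrib cong: if_cong)
  hence "det (mat k k (\<lambda>(i, j). (if i = j then f i else 0) - g j)) = det (1\<^sub>m k - U * W) * det F"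
    using det_mult[OF minus_carrier_mat[OF mult_carrier_mat[OF UW(1,2)]] UW(3)] by simp
  also have "det (1\<^sub>m k - U * W) = det (1\<^sub>m 1 - W * U)"
    by (rule det_one_minus_mult_comm[OF UW(1,2)])
  also have "1\<^sub>m 1 - W * U = mat 1 1 (\<lambda>(i, j). if i = j then 1 - (\<Sum>i<k. g i / f i) else 0)"
    by (rule eq_matI) (auto simp: U_def W_def scalar_prod_def lessThan_atLeast0)
  also have "det \<dots> = 1 - (\<Sum>i<k. g i / f i)" by (subst det_diagonal) simp
  also have "det F = (\<Prod>i<k. f i)" unfolding F_def by (rule det_diagonal)
  finally show ?thesis by (simp add: mult.commute)
qed

lemma poly_char_poly:
  assumes "(A :: 'a :: field mat) \<in> carrier_mat n n"
  shows "poly (char_poly A) z = det (z \<cdot>\<^sub>m 1\<^sub>m n - A)"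
proof -
  have "- char_matrix A z = z \<cdot>\<^sub>m 1\<^sub>m n - A"
    by (rule eq_matI) (use assms in \<open>auto simp: char_matrix_def\<close>)
  thus ?thesis using char_poly_matrix[OF assms] by simp
qed

text \<open>The adjacency matrix factors through the parts as \<open>A = C * R\<close>, so
  Sylvester's identity replaces the \<open>n\<close> by \<open>n\<close> determinant by a
  \<open>k\<close> by \<open>k\<close> one that depends only on the part sizes.\<close>

lemma poly_char_poly_multipartite:
  assumes M: "multipartite_parts G P" and vs: "distinct vs" "set vs = pverts G"
    and z: "z \<noteq> 0" "\<And>X. X \<in> P \<Longrightarrow> z + of_nat (card X) \<noteq> 0"
  shows "z ^ card P * poly (char_poly (adjacency_matrix G vs)) z =
    z ^ card (pverts G) * ((\<Prod>X\<in>P. z + of_nat (card X)) * (1 - (\<Sum>X\<in>P. of_nat (card X) / (z + of_nat (card X)))))"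
proof -
  note MD = multipartite_partsD[OF M]
  obtain Ps where Ps: "distinct Ps" "set Ps = P" using finite_distinct_list[OF MD(2)] by blast
  define n k A where "n = length vs" and "k = length Ps" and "A = adjacency_matrix G vs"
  have nk: "card (pverts G) = n" "card P = k" using vs Ps by (auto simp: n_def k_def dest: distinct_card)
  have bijP: "bij_betw ((!) Ps) {..<k} P" using bij_betw_nth[OF Ps(1)] Ps(2) by (simp add: k_def)
  have bijV: "bij_betw ((!) vs) {..<n} (pverts G)" using bij_betw_nth[OF vs(1)] vs(2) by (simp add: n_def)
  have PsP: "Ps ! j \<in> P" if "j < k" for j using that Ps by (auto simp: k_def)
  have Ps_eq: "Ps ! i = Ps ! j \<longleftrightarrow> i = j" if "i < k" "j < k" for i j
    using that Ps(1) by (simp add: k_def nth_eq_iff_index_eq)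
  have in_unique: "i = j" if "i < k" "j < k" "a \<in> Ps ! i" "a \<in> Ps ! j" for a i j
    using disjointD[OF MD(5) PsP[OF that(1)] PsP[OF that(2)]] Ps_eq[OF that(1,2)] that(3,4) by blast
  \<comment> \<open>\<open>C\<close> is the incidence of vertices with parts; row \<open>j\<close>
    of \<open>R\<close> marks the vertices of the parts other than part \<open>j\<close>.\<close>
  define C where "C = mat n k (\<lambda>(i, j). if vs ! i \<in> Ps ! j then 1 else (0 :: complex))"
  define R where "R = mat k n (\<lambda>(j, i). if vs ! i \<in> \<Union>P - Ps ! j then 1 else (0 :: complex))"
  have A: "A \<in> carrier_mat n n" and C: "C \<in> carrier_mat n k" and R: "R \<in> carrier_mat k n"
    by (auto simp: A_def adjacency_matrix_def n_def C_def R_def)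
  have "A = C * R"
  proof (rule eq_matI)
    fix a b assume "a < dim_row (C * R)" "b < dim_col (C * R)"
    hence ab: "a < n" "b < n" using C R by auto
    have "(C * R) $$ (a, b) =
        (\<Sum>j<k. if vs ! a \<in> Ps ! j \<and> vs ! b \<in> \<Union>P - Ps ! j then 1 else 0)"
      using ab by (auto simp: C_def R_def scalar_prod_def lessThan_atLeast0 intro!: sum.cong)
    also have "\<dots> = A $$ (a, b)"
    proof (cases "\<exists>j<k. vs ! a \<in> Ps ! j \<and> vs ! b \<in> \<Union>P - Ps ! j")
      case True
      then obtain j where j: "j < k" "vs ! a \<in> Ps ! j" "vs ! b \<in> \<Union>P - Ps ! j" by blast
      have "(\<Sum>j<k. if vs ! a \<in> Ps ! j \<and> vs ! b \<in> \<Union>P - Ps ! j then 1 else 0) = (\<Sum>i<k. if i = j then 1 else (0 :: complex))"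
        using j in_unique by (intro sum.cong) auto
      also have "\<dots> = 1" using j(1) by simp
      also from j obtain Y where "Y \<in> P" "vs ! b \<in> Y" "Y \<noteq> Ps ! j" by blast
      hence "(vs ! a, vs ! b) \<in> parcs G" using MD(7)[OF PsP[OF j(1)]] j(2) by blast
      hence "1 = A $$ (a, b)" using ab by (simp add: A_def adjacency_matrix_def n_def)
      finally show ?thesis .
    next
      case False
      have "(vs ! a, vs ! b) \<notin> parcs G"
      proof
        assume "(vs ! a, vs ! b) \<in> parcs G"
        then obtain X Y where XY: "X \<in> P" "Y \<in> P" "X \<noteq> Y" "vs ! a \<in> X" "vs ! b \<in> Y"
          using M by (auto simp: multipartite_parts_def)
        then obtain j where j: "j < k" "X = Ps ! j" using Ps(2) unfolding k_def by (metis in_set_conv_nth)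
        have "vs ! b \<notin> X" using disjointD[OF MD(5) XY(1-3)] XY(5) by blast
        with False j XY show False by blast
      qed
      hence "A $$ (a, b) = 0" using ab by (simp add: A_def adjacency_matrix_def n_def)
      with False show ?thesis by (auto intro!: sum.neutral)
    qed
    finally show "A $$ (a, b) = (C * R) $$ (a, b)" ..
  qed (use A C R in auto)
  define c where "c j = (of_nat (card (Ps ! j)) :: complex)" for j
  \<comment> \<open>The quotient matrix: entry \<open>(i, j)\<close> counts the vertices of part
    \<open>j\<close> outside part \<open>i\<close>.\<close>
  have RC: "R * C = mat k k (\<lambda>(i, j). if i = j then 0 else c j)"
  proof (rule eq_matI)
    fix i j assume "i < dim_row (mat k k (\<lambda>(i, j). if i = j then 0 else c j))"
      "j < dim_col (mat k k (\<lambda>(i, j). if i = j then 0 else c j))"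
    hence ij: "i < k" "j < k" by auto
    have iff: "a \<in> \<Union>P - Ps ! i \<and> a \<in> Ps ! j \<longleftrightarrow> i \<noteq> j \<and> a \<in> Ps ! j" for a
      using in_unique[OF ij] PsP[OF ij(2)] by blast
    have "(R * C) $$ (i, j) = (\<Sum>l<n. if vs ! l \<in> \<Union>P - Ps ! i \<and> vs ! l \<in> Ps ! j then 1 else 0)"
      using ij by (auto simp: C_def R_def scalar_prod_def lessThan_atLeast0 intro!: sum.cong)
    also have "\<dots> = (\<Sum>a\<in>pverts G. if a \<in> \<Union>P - Ps ! i \<and> a \<in> Ps ! j then 1 else 0)"
      using sum.reindex_bij_betw[OF bijV, of "\<lambda>a. if a \<in> \<Union>P - Ps ! i \<and> a \<in> Ps ! j then 1 else (0 :: complex)"] .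
    also have "\<dots> = (if i = j then 0 else c j)"
    proof (cases "i = j")
      case False
      have "pverts G \<inter> Ps ! j = Ps ! j" using MD(6) PsP[OF ij(2)] by blast
      with False show ?thesis unfolding iff by (simp add: sum.If_cases[OF MD(1)] c_def)
    qed (auto simp: iff)
    finally show "(R * C) $$ (i, j) = mat k k (\<lambda>(i, j). if i = j then 0 else c j) $$ (i, j)" using ij by simp
  qed (use C R in auto)
  have "z \<cdot>\<^sub>m 1\<^sub>m n - A = z \<cdot>\<^sub>m (1\<^sub>m n - (inverse z \<cdot>\<^sub>m C) * R)"
    using C R z by (intro eq_matI) (auto simp: \<open>A = C * R\<close> right_diff_distrib)
  hence "poly (char_poly A) z = z ^ n * det (1\<^sub>m n - (inverse z \<cdot>\<^sub>m C) * R)"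
    using C R by (simp add: poly_char_poly[OF A] det_smult)
  also have "det (1\<^sub>m n - (inverse z \<cdot>\<^sub>m C) * R) = det (1\<^sub>m k - R * (inverse z \<cdot>\<^sub>m C))"
    using C R by (intro det_one_minus_mult_comm) auto
  finally have 1: "z ^ k * poly (char_poly A) z = z ^ n * (z ^ k * det (1\<^sub>m k - R * (inverse z \<cdot>\<^sub>m C)))" by simp
  have "z ^ k * det (1\<^sub>m k - R * (inverse z \<cdot>\<^sub>m C)) = det (z \<cdot>\<^sub>m (1\<^sub>m k - R * (inverse z \<cdot>\<^sub>m C)))"
    using C R by (simp add: det_smult)
  \<comment> \<open>With \<open>z + c i\<close> instead of \<open>z\<close> on the diagonal, the
    subtracted matrix has all its rows equal to \<open>c\<close>, as the determinant lemma
    requires.\<close>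
  also have "z \<cdot>\<^sub>m (1\<^sub>m k - R * (inverse z \<cdot>\<^sub>m C)) = mat k k (\<lambda>(i, j). (if i = j then z + c i else 0) - c j)"
    unfolding mult_smult_distrib[OF R C] RC using z
    by (intro eq_matI) (auto simp: right_diff_distrib)
  also have "det \<dots> = (\<Prod>i<k. z + c i) * (1 - (\<Sum>i<k. c i / (z + c i)))"
    using z(2) PsP by (intro det_diagonal_minus_rank_one) (auto simp: c_def)
  also have "(\<Prod>i<k. z + c i) = (\<Prod>X\<in>P. z + of_nat (card X))"
    unfolding c_def using prod.reindex_bij_betw[OF bijP, of "\<lambda>X. z + of_nat (card X)"] .
  also have "(\<Sum>i<k. c i / (z + c i)) = (\<Sum>X\<in>P. of_nat (card X) / (z + of_nat (card X)))"
    unfolding c_def using sum.reindex_bij_betw[OF bijP, of "\<lambda>X. of_nat (card X) / (z + of_nat (card X))"] .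
  finally show ?thesis using 1 unfolding nk A_def by simp
qed

section \<open>Polynomials attached to the multiset of part sizes\<close>

definition part_poly :: "nat multiset \<Rightarrow> complex poly" where
  "part_poly M = (\<Prod>a\<in>#M. [:of_nat a, 1:])"

lemma part_poly_simps [simp]:
  "part_poly {#} = 1" "part_poly (add_mset a M) = [:of_nat a, 1:] * part_poly M"
  by (simp_all add: part_poly_def)

lemma poly_part_poly: "poly (part_poly M) z = (\<Prod>a\<in>#M. z + of_nat a)"
  by (induction M) (auto simp: algebra_simps)

text \<open>The logarithmic derivative of a product. At \<open>z = 0\<close> it yields the sum of
  the reciprocals of the part sizes.\<close>

lemma poly_pderiv_part_poly:
  assumes "\<And>a. a \<in># M \<Longrightarrow> z + of_nat a \<noteq> 0"
  shows "poly (pderiv (part_poly M)) z = poly (part_poly M) z * (\<Sum>a\<in>#M. 1 / (z + of_nat a))"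
  using assms
proof (induction M)
  case (add a M)
  have za: "z + of_nat a \<noteq> 0" by (rule add.prems) simp
  define s where "s = (\<Sum>a\<in>#M. 1 / (z + of_nat a))"
  have IH: "poly (pderiv (part_poly M)) z = poly (part_poly M) z * s"
    unfolding s_def by (rule add.IH) (use add.prems in auto)
  have "pderiv (part_poly (add_mset a M)) = [:of_nat a, 1:] * pderiv (part_poly M) + part_poly M"
    unfolding part_poly_simps pderiv_mult by (simp add: pderiv_pCons)
  hence "poly (pderiv (part_poly (add_mset a M))) z = (z + of_nat a) * poly (part_poly M) z * s + poly (part_poly M) z"
    by (simp add: IH algebra_simps)
  also have "\<dots> = (z + of_nat a) * poly (part_poly M) z * (1 / (z + of_nat a) + s)"
    using za by (simp add: distrib_left)
  also have "\<dots> = poly (part_poly (add_mset a M)) z * (\<Sum>a\<in>#add_mset a M. 1 / (z + of_nat a))"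
    by (simp add: s_def algebra_simps)
  finally show ?case .
qed simp

lemma proots_part_poly: "proots (part_poly M) = image_mset (\<lambda>a. - of_nat a) M"
proof (induction M)
  case (add a M)
  have "part_poly M \<noteq> 0" by (auto simp: part_poly_def)
  with add show ?case by (simp add: proots_mult del: mult_pCons_left)
qed simp

lemma part_poly_inject: "part_poly M = part_poly L \<Longrightarrow> M = L"
proof -
  assume "part_poly M = part_poly L"
  hence "image_mset (\<lambda>a. - of_nat a :: complex) M = image_mset (\<lambda>a. - of_nat a) L"
    by (metis proots_part_poly)
  moreover have "inj (\<lambda>a. - of_nat a :: complex)" by (auto simp: inj_def)
  ultimately show ?thesis using multiset.inj_map by (blast dest: injD)
qed

lemma of_nat_prod_mset: "of_nat (prod_mset M) = (\<Prod>a\<in>#M. of_nat a :: 'a :: comm_semiring_1)"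
  by (induction M) auto

lemma of_real_sum_mset_inverse:
  "complex_of_real (\<Sum>a\<in>#M. 1 / real a) = (\<Sum>a\<in>#M. 1 / complex_of_nat a)"
  by (induction M) auto

text \<open>With \<open>e\<^sub>i\<close> the elementary symmetric functions of the part sizes, this is
  \<open>\<Sum>i. (1 - i) e\<^sub>i x\<^bsup>k-i\<^esup>\<close>; only the number \<open>e\<^sub>1\<close> of non-isolated vertices is lost.\<close>

definition multipartite_poly :: "nat multiset \<Rightarrow> complex poly" where
  "multipartite_poly M = [:0, 1:] * pderiv (part_poly M) - Polynomial.smult (of_nat (size M) - 1) (part_poly M)"

text \<open>Writing \<open>a / (z + a)\<close> as \<open>1 - z / (z + a)\<close> turns the sum into
  the logarithmic derivative of \<open>part_poly M\<close>, and the factor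
  \<open>part_poly M\<close> clears the denominators.\<close>

lemma poly_multipartite_poly:
  assumes "\<And>a. a \<in># M \<Longrightarrow> z + of_nat a \<noteq> 0"
  shows "poly (multipartite_poly M) z = poly (part_poly M) z * (1 - (\<Sum>a\<in>#M. of_nat a / (z + of_nat a)))"
proof -
  define s where "s = (\<Sum>a\<in>#M. 1 / (z + of_nat a))"
  have "(\<Sum>a\<in>#M. of_nat a / (z + of_nat a)) = (\<Sum>a\<in>#M. 1 - z * (1 / (z + of_nat a)))"
    using assms by (intro arg_cong[of _ _ sum_mset] image_mset_cong) (simp add: field_simps)
  also have "\<dots> = of_nat (size M) - z * (\<Sum>a\<in>#M. 1 / (z + of_nat a))"
    by (induction M) (auto simp: algebra_simps)
  finally have t: "(\<Sum>a\<in>#M. of_nat a / (z + of_nat a)) = of_nat (size M) - z * s" by (simp only: s_def)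
  have "poly (pderiv (part_poly M)) z = poly (part_poly M) z * s"
    unfolding s_def by (rule poly_pderiv_part_poly) (rule assms)
  hence "poly (multipartite_poly M) z = z * (poly (part_poly M) z * s) - (of_nat (size M) - 1) * poly (part_poly M) z"
    by (simp add: multipartite_poly_def)
  thus ?thesis unfolding t by (simp add: algebra_simps)
qed

lemma poly_eq_if_eq_cofinite:
  fixes f g :: "complex poly"
  assumes "finite F" "\<And>z. z \<notin> F \<Longrightarrow> poly f z = poly g z"
  shows "f = g"
proof (rule ccontr)
  assume "f \<noteq> g"
  hence "finite {z. poly (f - g) z = 0}" by (intro poly_roots_finite) simp
  moreover have "- F \<subseteq> {z. poly (f - g) z = 0}" using assms(2) by auto
  ultimately have "finite (- F)" by (rule rev_finite_subset)
  with assms(1) have "finite (UNIV :: complex set)" by (metis finite_compl)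
  thus False using infinite_UNIV_char_0 by blast
qed

text \<open>Both sides agree off the finitely many \<open>z\<close> excluded in
  \<open>poly_char_poly_multipartite\<close>, hence as polynomials. Keeping the two powers of
  \<open>x\<close> on opposite sides avoids a subtraction of exponents.\<close>

lemma char_poly_multipartite:
  assumes M: "multipartite_parts G P" and vs: "distinct vs" "set vs = pverts G"
  shows "monom 1 (card P) * char_poly (adjacency_matrix G vs) =
    monom 1 (card (pverts G)) * multipartite_poly (image_mset card (mset_set P))"
proof (rule poly_eq_if_eq_cofinite)
  note MD = multipartite_partsD[OF M]
  show "finite (insert 0 ((\<lambda>X. - complex_of_nat (card X)) ` P))" using MD(2) by simp
  fix z assume "z \<notin> insert 0 ((\<lambda>X. - complex_of_nat (card X)) ` P)"
  hence z: "z \<noteq> 0" "\<And>X. X \<in> P \<Longrightarrow> z + of_nat (card X) \<noteq> 0"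
    by (auto simp: add_eq_0_iff2)
  have "poly (multipartite_poly (image_mset card (mset_set P))) z =
     (\<Prod>X\<in>P. z + of_nat (card X)) * (1 - (\<Sum>X\<in>P. of_nat (card X) / (z + of_nat (card X))))"
    using z(2) MD(2)
    by (subst poly_multipartite_poly)
       (auto simp: poly_part_poly prod_unfold_prod_mset sum_unfold_sum_mset image_mset.compositionality o_def)
  thus "poly (monom 1 (card P) * char_poly (adjacency_matrix G vs)) z =
    poly (monom 1 (card (pverts G)) * multipartite_poly (image_mset card (mset_set P))) z"
    using poly_char_poly_multipartite[OF M vs z] by (simp add: poly_monom)
qed

lemma coeff_0_multipartite_poly:
  "coeff (multipartite_poly M) 0 = (1 - of_nat (size M)) * of_nat (prod_mset M)"
proof -
  have "poly (multipartite_poly M) 0 = (1 - of_nat (size M)) * of_nat (prod_mset M)"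
    by (simp add: multipartite_poly_def poly_part_poly of_nat_prod_mset left_diff_distrib)
  thus ?thesis by (simp add: poly_0_coeff_0)
qed

text \<open>\<open>f\<close> is the common characteristic polynomial of two graphs on
  \<open>n\<close> vertices. Both instances of \<open>multipartite_poly\<close> have a nonzero
  constant coefficient, since no part is empty and the number of parts is not 1; comparing the
  orders of vanishing at 0 therefore equates the numbers of parts.\<close>

lemma multipartite_poly_size_eq:
  assumes eq: "monom 1 (size M) * f = monom 1 n * multipartite_poly M"
      "monom 1 (size L) * f = monom 1 n * multipartite_poly L"
    and M: "0 \<notin># M" "size M \<noteq> 1" and L: "0 \<notin># L" "size L \<noteq> 1"
  shows "size M = size L" "multipartite_poly M = multipartite_poly L"
proof -
  have "monom 1 n * (monom 1 (size L) * multipartite_poly M) = monom 1 n * (monom 1 (size M) * multipartite_poly L)"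
    using arg_cong[OF eq(1), of "\<lambda>g. monom 1 (size L) * g"] arg_cong[OF eq(2), of "\<lambda>g. monom 1 (size M) * g"]
    by (simp only: mult.left_commute)
  hence *: "monom 1 (size L) * multipartite_poly M = monom 1 (size M) * multipartite_poly L"
    by (simp add: monom_eq_0_iff)
  have nz: "coeff (multipartite_poly K) 0 \<noteq> 0" if "0 \<notin># K" "size K \<noteq> 1" for K
  proof -
    have "of_nat (size K) \<noteq> (1 :: complex)" using that(2) by (metis of_nat_1 of_nat_eq_iff)
    thus ?thesis using that(1) by (simp add: coeff_0_multipartite_poly prod_mset_zero_iff)
  qed
  show size: "size M = size L"
  proof (rule linorder_cases[of "size M" "size L"])
    assume lt: "size M < size L"
    from arg_cong[OF *, of "\<lambda>f. coeff f (size M)"] lt nz[OF L] show ?thesis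
      by (simp add: coeff_monom_mult)
  next
    assume lt: "size L < size M"
    from arg_cong[OF *, of "\<lambda>f. coeff f (size L)"] lt nz[OF M] show ?thesis
      by (simp add: coeff_monom_mult)
  qed
  show "multipartite_poly M = multipartite_poly L"
    using * unfolding size by (simp add: monom_eq_0_iff)
qed

text \<open>The difference \<open>D\<close> is killed by the operator
  \<open>x D' - (k - 1) D\<close>, which multiplies \<open>x^j\<close> by
  \<open>j - (k - 1)\<close>; only the coefficient at \<open>k - 1\<close> survives.\<close>

lemma part_poly_diff:
  assumes "multipartite_poly M = multipartite_poly L" "size M = k" "size L = k" "k \<noteq> 0"
  obtains c where "part_poly M - part_poly L = monom c (k - 1)"
proof -
  define D where "D = part_poly M - part_poly L"
  have D: "[:0, 1:] * pderiv D = Polynomial.smult (of_nat k - 1) D"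
  proof -
    have "[:0, 1:] * pderiv D - Polynomial.smult (of_nat k - 1) D = multipartite_poly M - multipartite_poly L"
      by (simp add: D_def multipartite_poly_def assms(2,3) pderiv_diff right_diff_distrib smult_diff_right)
    thus ?thesis using assms(1) by simp
  qed
  have "coeff D j = 0" if "j \<noteq> k - 1" for j
  proof -
    have "coeff ([:0, 1:] * pderiv D) j = of_nat j * coeff D j"
      by (cases j) (simp_all add: coeff_pderiv)
    hence "(of_nat j - of_nat (k - 1)) * coeff D j = 0"
      using D assms(4) by (simp add: algebra_simps of_nat_diff)
    thus ?thesis using that by simp
  qed
  hence "D = monom (coeff D (k - 1)) (k - 1)" by (intro poly_eqI) auto
  thus ?thesis using that by (simp add: D_def)
qed

section \<open>Prime-power part sizes with prescribed product and reciprocal sum\<close>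

text \<open>Every part is a power of \<open>p\<close> other than 1, so it is \<open>p\<close> or at
  least \<open>p^2\<close>. These bounds leave only \<open>v = 1\<close> with at least
  \<open>p\<close> parts equal to \<open>p\<close>, where the sum and the product contradict each
  other.\<close>

lemma no_other_prime_power_parts:
  fixes p q v :: nat
  assumes p: "prime p" and q: "q = p ^ j" and v: "v \<ge> 1" and M: "size M = v + p" "prod_mset M = q ^ p" "1 \<notin># M"
    and sum: "(\<Sum>a\<in>#M. 1 / real a) = real v + real p / real q"
  shows False
proof -
  have p2: "p \<ge> 2" using p by (rule prime_ge_2_nat)
  have q0: "q > 0" using p2 q by simp
  have pq: "real p / real q > 0" using p2 q0 by simp
  have pp: "p dvd a" if "a \<in># M" for a
  proof -
    have "a dvd p ^ (j * p)" using dvd_prod_mset[OF that] M(2) q by (simp add: power_mult)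
    then obtain i where "a = p ^ i" using divides_primepow_nat[OF p] by auto
    moreover have "i \<noteq> 0" using calculation that M(3) by (metis power_0)
    ultimately show ?thesis by simp
  qed
  have pp2: "a \<ge> p ^ 2" if "a \<in># M" "a \<noteq> p" for a
  proof -
    have "a dvd p ^ (j * p)" using dvd_prod_mset[OF that(1)] M(2) q by (simp add: power_mult)
    then obtain i where i: "a = p ^ i" using divides_primepow_nat[OF p] by auto
    have "i \<noteq> 0" using i that M(3) by (metis power_0)
    moreover have "i \<noteq> 1" using i that(2) by auto
    ultimately have "2 \<le> i" by simp
    thus ?thesis unfolding i using p2 by (intro power_increasing) auto
  qed
  have a0: "a > 0" if "a \<in># M" for a
  proof -
    have "prod_mset M \<noteq> 0" using M(2) q0 by simp
    thus ?thesis using that by (metis gr0I prod_mset_zero_iff)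
  qed
  \<comment> \<open>All parts being at least \<open>p\<close>, the sum gives
    \<open>v + p / q \<le> 1 + v / p\<close>. As \<open>p / q > 0\<close>, this makes
    \<open>v < 1 + v / 2\<close>.\<close>
  have "(\<Sum>a\<in>#M. 1 / real a) \<le> (\<Sum>a\<in>#M. 1 / real p)"
    using a0 p2 pp by (intro sum_mset_mono) (auto simp: frac_le dvd_imp_le)
  also have "\<dots> = 1 + real v / real p" using p2 by (simp add: M field_simps)
  finally have "real v < 1 + real v / real p" using sum pq by linarith
  also have "real v / real p \<le> real v / 2" using p2 by (intro divide_left_mono) auto
  finally have "v = 1" using v by linarith
  define t where "t = count M p"
  define M' where "M' = filter_mset (\<lambda>a. a \<noteq> p) M"
  have Mt: "M = replicate_mset t p + M'"
    unfolding t_def M'_def by (metis filter_eq_replicate_mset multiset_partition)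
  have size: "t + size M' = p + 1" using M(1) \<open>v = 1\<close> by (subst (asm) Mt) simp
  have prod: "p ^ t * prod_mset M' = q ^ p" using M(2) by (subst (asm) Mt) simp
  have sum': "real t / real p + (\<Sum>a\<in>#M'. 1 / real a) = 1 + real p / real q"
    using sum \<open>v = 1\<close> by (subst (asm) Mt) simp
  have M'_ge: "a \<ge> p ^ 2" if "a \<in># M'" for a using that pp2 by (simp add: M'_def)
  consider "t = p + 1" | "t = p" | "t \<le> p - 1" using size by linarith
  thus False
  proof cases
    \<comment> \<open>All parts equal \<open>p\<close>: the sum gives \<open>q = p^2\<close>, and
      the product becomes \<open>p^(p+1) = p^(2p)\<close>.\<close>
    case 1
    hence "M' = {#}" using size by simp
    with sum' 1 have "real (p + 1) / real p = 1 + real p / real q" by simp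
    hence "real q = real (p ^ 2)" using p2 q0 by (simp add: field_simps power2_eq_square)
    hence "q = p ^ 2" by (simp only: of_nat_eq_iff)
    with prod 1 \<open>M' = {#}\<close> have "p ^ (p + 1) = p ^ (2 * p)" by (simp add: power_mult)
    hence "p + 1 = 2 * p" using p2 by (subst (asm) power_inject_exp) auto
    thus False using p2 by simp
  next
    \<comment> \<open>One further part \<open>X\<close>: the sum gives \<open>q = p * X\<close>, and
      the product reduces to \<open>X = X^p\<close>.\<close>
    case 2
    hence "size M' = 1" using size by simp
    then obtain X where X: "M' = {#X#}" using size_1_singleton_mset by blast
    have "X \<ge> p ^ 2" using M'_ge X by simp
    moreover have "1 < p ^ 2" using p2 by (intro one_less_power) auto
    ultimately have X1: "X > 1" by linarith
    have "1 / real X = real p / real q" using sum' 2 X p2 by simp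
    hence "real q = real (p * X)" using X1 q0 by (simp add: field_simps)
    hence "q = p * X" by (simp only: of_nat_eq_iff)
    with prod 2 X have "p ^ p * X = p ^ p * X ^ p" by (simp add: power_mult_distrib)
    hence "X ^ 1 = X ^ p" using p2 by simp
    hence "1 = p" using X1 by (subst (asm) power_inject_exp) auto
    thus False using p2 by simp
  next
    \<comment> \<open>At least two parts are \<open>p^2\<close> or larger, and the sum is too small:
      exceeding 1 needs \<open>t (p - 1) > p^2 - p - 1\<close>, whereas
      \<open>t (p - 1) \<le> (p - 1)^2\<close>, so that \<open>p < 2\<close>.\<close>
    case 3
    have "(\<Sum>a\<in>#M'. 1 / real a) \<le> (\<Sum>a\<in>#M'. 1 / real (p ^ 2))"
      using M'_ge p2 by (intro sum_mset_mono frac_le) (auto simp flip: of_nat_power)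
    also have "\<dots> = real (size M') / real p ^ 2" by simp
    also have "real (size M') = real p + 1 - real t" using size by linarith
    finally have "real t / real p + (real p + 1 - real t) / real p ^ 2 > 1"
      using sum' pq by linarith
    hence "real t * real p + (real p + 1 - real t) > real p ^ 2"
      using p2 by (simp add: field_simps power2_eq_square)
    moreover have "real t * (real p - 1) \<le> (real p - 1) * (real p - 1)"
      using 3 p2 by (intro mult_right_mono) auto
    ultimately show False using p2 by (simp add: algebra_simps power2_eq_square)
  qed
qed

text \<open>The part polynomials differ by \<open>c x^(v+p-1)\<close>. As
  \<open>v + p - 1 \<ge> 2\<close>, this changes neither the value nor the derivative at 0, which
  fixes the product and the reciprocal sum of the parts even if \<open>c\<close> is nonzero.\<close>

lemma multipartite_poly_determines_parts:
  fixes p q v :: nat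
  assumes p: "prime p" and q: "q = p ^ j" and v: "v \<ge> 1"
    and eq: "multipartite_poly M = multipartite_poly (replicate_mset v 1 + replicate_mset p q)"
    and size: "size M = v + p" and M0: "0 \<notin># M"
  shows "M = replicate_mset v 1 + replicate_mset p q"
proof -
  define L where "L = replicate_mset v 1 + replicate_mset p q"
  have p2: "p \<ge> 2" using p by (rule prime_ge_2_nat)
  have q0: "q > 0" using p2 q by simp
  obtain c where c: "part_poly L - part_poly M = monom c (v + p - 1)"
    by (rule part_poly_diff[of L M "v + p"]) (use eq size p2 in \<open>auto simp: L_def\<close>)
  have "c = 0"
  proof (rule ccontr)
    assume "c \<noteq> 0"
    have L0: "0 \<notin># L" using q0 by (auto simp: L_def)
    have pL: "poly (part_poly L) z = (z + 1) ^ v * (z + of_nat q) ^ p" for z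
      by (simp add: L_def poly_part_poly)
    have eval: "poly (part_poly L) z = poly (part_poly M) z + c * z ^ (v + p - 1)" for z
      using arg_cong[OF c, of "\<lambda>f. poly f z"] by (simp add: poly_monom algebra_simps)
    have e0: "poly (part_poly L) 0 = poly (part_poly M) 0"
      using eval[of 0] p2 v by simp
    have "of_nat (prod_mset M) = (of_nat (q ^ p) :: complex)"
      using e0 unfolding pL by (simp add: poly_part_poly of_nat_prod_mset)
    hence prod: "prod_mset M = q ^ p" by (simp only: of_nat_eq_iff)
    have "part_poly L = part_poly M + monom c (v + p - 1)" using c by (simp add: algebra_simps)
    hence "poly (pderiv (part_poly L)) 0 = poly (pderiv (part_poly M)) 0"
      using p2 v by (simp add: pderiv_add pderiv_monom poly_monom)
    moreover have "poly (part_poly M) 0 \<noteq> 0"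
      using e0 q0 unfolding pL by auto
    moreover define s where "s K = (\<Sum>a\<in>#K. 1 / complex_of_nat a)" for K
    have "poly (pderiv (part_poly K)) 0 = poly (part_poly K) 0 * s K" if "0 \<notin># K" for K
      unfolding s_def using poly_pderiv_part_poly[of K 0, unfolded add_0] that by fastforce
    ultimately have "s M = s L" using L0 M0 e0 by simp
    hence "complex_of_real (\<Sum>a\<in>#M. 1 / real a) = complex_of_real (\<Sum>a\<in>#L. 1 / real a)"
      unfolding of_real_sum_mset_inverse s_def .
    hence "(\<Sum>a\<in>#M. 1 / real a) = (\<Sum>a\<in>#L. 1 / real a)" by (simp only: of_real_eq_iff)
    hence sum: "(\<Sum>a\<in>#M. 1 / real a) = real v + real p / real q" by (simp add: L_def)
    \<comment> \<open>\<open>part_poly L\<close> vanishes at \<open>-1\<close> because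
      \<open>v \<ge> 1\<close>, so \<open>part_poly M\<close> takes there the nonzero value
      \<open>- c * (-1)^(v+p-1)\<close>.\<close>
    have "poly (part_poly M) (-1) \<noteq> 0"
      using eval[of "-1"] v \<open>c \<noteq> 0\<close> unfolding pL by (auto simp: power_0_left)
    hence "1 \<notin># M" by (auto simp: poly_part_poly prod_mset_zero_iff)
    thus False using no_other_prime_power_parts[OF p q v size prod _ sum] by blast
  qed
  with c have "part_poly L = part_poly M" by simp
  thus ?thesis using part_poly_inject by (simp add: L_def)
qed

section \<open>Isomorphism and the multicone graph\<close>

lemma bij_betw_if_image_mset_eq:
  assumes "finite A" "finite B" "image_mset f (mset_set A) = image_mset g (mset_set B)"
  shows "\<exists>\<sigma>. bij_betw \<sigma> A B \<and> (\<forall>x\<in>A. g (\<sigma> x) = f x)"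
  using assms
proof (induction A arbitrary: B rule: finite_induct)
  case empty
  hence "B = {}" by (simp add: mset_set_empty_iff)
  thus ?case by (simp add: bij_betw_def)
next
  case (insert x A)
  have "f x \<in># image_mset g (mset_set B)" by (subst insert.prems(2)[symmetric]) (use insert.hyps in simp)
  then obtain y where y: "y \<in> B" "g y = f x" using insert.prems(1) by auto
  have B: "mset_set B = add_mset y (mset_set (B - {y}))"
    using mset_set.remove[OF insert.prems(1) y(1)] .
  have "image_mset f (mset_set A) = image_mset g (mset_set (B - {y}))"
    using insert.prems(2) insert.hyps y(2) unfolding B by simp
  from insert.IH[OF _ this] insert.prems(1) obtain \<sigma> where
    \<sigma>: "bij_betw \<sigma> A (B - {y})" "\<forall>x\<in>A. g (\<sigma> x) = f x" by auto
  have "bij_betw (\<sigma>(x := y)) A (B - {y})"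
    using \<sigma>(1) insert.hyps by (subst bij_betw_cong[of _ _ \<sigma>]) auto
  moreover have "bij_betw (\<sigma>(x := y)) {x} {y}" by (simp add: bij_betw_def)
  ultimately have "bij_betw (\<sigma>(x := y)) (A \<union> {x}) (B - {y} \<union> {y})"
    by (rule bij_betw_combine) auto
  moreover have "A \<union> {x} = insert x A" "B - {y} \<union> {y} = B" using y by auto
  ultimately have "bij_betw (\<sigma>(x := y)) (insert x A) B" by simp
  moreover have "\<forall>z\<in>insert x A. g ((\<sigma>(x := y)) z) = f z" using \<sigma>(2) y(2) insert.hyps by auto
  ultimately show ?case by blast
qed

text \<open>An arc is its pair of ends, so \<open>map_prod h h\<close> serves as the arc map. It is
  onto because the ends of every arc of \<open>H\<close> are vertices and thus images under
  \<open>h\<close>.\<close>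

lemma digraph_iso_with_proj:
  assumes G: "pair_graph G" and h: "bij_betw h (pverts G) (pverts H)"
    and H: "parcs H \<subseteq> pverts H \<times> pverts H"
    and arcs: "\<And>x y. x \<in> pverts G \<Longrightarrow> y \<in> pverts G \<Longrightarrow> (h x, h y) \<in> parcs H \<longleftrightarrow> (x, y) \<in> parcs G"
  shows "digraph_iso (with_proj G) (with_proj H)"
proof -
  interpret pair_graph G by fact
  let ?f = "\<lparr> iso_verts = h, iso_arcs = map_prod h h, iso_head = snd, iso_tail = fst \<rparr>"
  have inj: "inj_on h (pverts G)" and img: "h ` pverts G = pverts H" using h by (auto simp: bij_betw_def)
  have sub: "parcs G \<subseteq> pverts G \<times> pverts G" using pair_graph_verts(3)[OF G] .
  have "inj_on (map_prod h h) (parcs G)"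
    using map_prod_inj_on[OF inj inj] sub by (rule inj_on_subset)
  hence "pre_digraph.digraph_isomorphism (with_proj G) ?f"
    unfolding pre_digraph.digraph_isomorphism_def using inj wf_digraph_axioms by auto
  moreover have "map_prod h h ` parcs G = parcs H"
  proof (intro equalityI subrelI)
    fix x y assume "(x, y) \<in> map_prod h h ` parcs G"
    thus "(x, y) \<in> parcs H" using arcs sub by auto
  next
    fix x y assume xy: "(x, y) \<in> parcs H"
    with H img obtain a b where ab: "a \<in> pverts G" "b \<in> pverts G" "x = h a" "y = h b" by blast
    hence "(a, b) \<in> parcs G" using arcs xy by blast
    thus "(x, y) \<in> map_prod h h ` parcs G" using ab by (metis map_prod_imageI)
  qed
  hence "with_proj H = app_iso ?f (with_proj G)"
    using img by (simp add: app_iso_def with_proj_def)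
  ultimately show ?thesis unfolding digraph_iso_def by blast
qed

text \<open>Bijections from each part \<open>X\<close> onto its partner \<open>\<sigma> X\<close>
  glue to a map that preserves lying in the same part. This decides adjacency, because the parts
  cover all vertices.\<close>

lemma multipartite_digraph_iso:
  assumes G: "multipartite_parts G P" "\<Union>P = pverts G" and H: "multipartite_parts H Q" "\<Union>Q = pverts H"
    and eq: "image_mset card (mset_set P) = image_mset card (mset_set Q)"
  shows "digraph_iso (with_proj G) (with_proj H)"
proof -
  note GD = multipartite_partsD[OF G(1)] and HD = multipartite_partsD[OF H(1)]
  obtain \<sigma> where \<sigma>: "bij_betw \<sigma> P Q" "\<And>X. X \<in> P \<Longrightarrow> card (\<sigma> X) = card X"
    using bij_betw_if_image_mset_eq[OF GD(2) HD(2) eq] by blast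
  have \<sigma>Q: "\<sigma> X \<in> Q" if "X \<in> P" for X using \<sigma>(1) that by (auto simp: bij_betw_def)
  have "\<exists>h. bij_betw h X (\<sigma> X)" if "X \<in> P" for X
    using that GD(3) HD(3) \<sigma>Q \<sigma>(2) by (intro finite_same_card_bij) auto
  then obtain \<eta> where \<eta>: "\<And>X. X \<in> P \<Longrightarrow> bij_betw (\<eta> X) X (\<sigma> X)" by metis
  define part where "part a = (THE X. X \<in> P \<and> a \<in> X)" for a
  have part: "part a = X" if "X \<in> P" "a \<in> X" for a X
    unfolding part_def
  proof (rule the_equality)
    fix Y assume "Y \<in> P \<and> a \<in> Y"
    thus "Y = X" using disjointD[OF GD(5), of X Y] that by blast
  qed (use that in blast)
  define h where "h a = \<eta> (part a) a" for a
  have hX: "bij_betw h X (\<sigma> X)" if "X \<in> P" for X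
    using \<eta>[OF that] by (subst bij_betw_cong[of _ _ "\<eta> X"]) (auto simp: h_def part[OF that])
  have "bij_betw h (\<Union>X\<in>P. X) (\<Union>X\<in>P. \<sigma> X)"
  proof (rule bij_betw_UNION_disjoint)
    show "disjoint_family_on \<sigma> P"
      unfolding disjoint_family_on_def using disjointD[OF HD(5)] \<sigma>Q \<sigma>(1)
      by (metis bij_betw_imp_inj_on inj_on_def)
  qed (rule hX)
  moreover have "(\<Union>X\<in>P. X) = pverts G" using G(2) by simp
  moreover have "(\<Union>X\<in>P. \<sigma> X) = pverts H" using H(2) \<sigma>(1) by (simp add: bij_betw_def)
  ultimately have bij: "bij_betw h (pverts G) (pverts H)" by simp
  show ?thesis
  proof (rule digraph_iso_with_proj[OF pair_graph_multipartite[OF G(1)] bij])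
    show "parcs H \<subseteq> pverts H \<times> pverts H" using pair_graph_verts(3)[OF pair_graph_multipartite[OF H(1)]] .
    fix x y assume xy: "x \<in> pverts G" "y \<in> pverts G"
    then obtain X Y where XY: "X \<in> P" "Y \<in> P" "x \<in> X" "y \<in> Y" using G(2) by blast
    have "h x \<in> \<sigma> X" "h y \<in> \<sigma> Y" using hX XY by (auto simp: bij_betw_def)
    hence "(h x, h y) \<in> parcs H \<longleftrightarrow> \<sigma> X \<noteq> \<sigma> Y" using HD(7) \<sigma>Q XY by blast
    also have "\<dots> \<longleftrightarrow> X \<noteq> Y" using \<sigma>(1) XY by (auto simp: bij_betw_def dest: inj_onD)
    also have "\<dots> \<longleftrightarrow> (x, y) \<in> parcs G" using GD(7) XY by blast
    finally show "(h x, h y) \<in> parcs H \<longleftrightarrow> (x, y) \<in> parcs G" .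
  qed
qed

section \<open>The multicone graph as a complete multipartite graph\<close>

text \<open>The parts are the fibres of the labelling \<open>l\<close>. Distinct attained labels
  have distinct fibres, so the part sizes can be counted label by label.\<close>

lemma multipartite_parts_labelling:
  assumes fin: "finite (pverts G)"
    and arcs: "\<And>x y. (x, y) \<in> parcs G \<longleftrightarrow> x \<in> pverts G \<and> y \<in> pverts G \<and> l x \<noteq> l y"
  defines "P \<equiv> (\<lambda>c. {x \<in> pverts G. l x = c}) ` l ` pverts G"
  shows "multipartite_parts G P" "\<Union>P = pverts G"
    "image_mset card (mset_set P) = image_mset (\<lambda>c. card {x \<in> pverts G. l x = c}) (mset_set (l ` pverts G))"
proof -
  show U: "\<Union>P = pverts G" by (auto simp: P_def)
  show "multipartite_parts G P"
    unfolding multipartite_parts_def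
  proof (intro conjI equalityI subrelI)
    fix x y assume "(x, y) \<in> parcs G"
    hence xy: "x \<in> pverts G" "y \<in> pverts G" "l x \<noteq> l y" using arcs by auto
    let ?X = "{z \<in> pverts G. l z = l x}" and ?Y = "{z \<in> pverts G. l z = l y}"
    have "?X \<in> P" "?Y \<in> P" "?X \<noteq> ?Y" "x \<in> ?X" "y \<in> ?Y" using xy by (auto simp: P_def)
    hence "\<exists>X\<in>P. \<exists>Y\<in>P. X \<noteq> Y \<and> x \<in> X \<and> y \<in> Y" by (intro bexI[of _ ?X] bexI[of _ ?Y] conjI)
    thus "(x, y) \<in> {(x, y). \<exists>X\<in>P. \<exists>Y\<in>P. X \<noteq> Y \<and> x \<in> X \<and> y \<in> Y}" by simp
  qed (use fin U in \<open>auto simp: P_def disjoint_def arcs\<close>)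
  have "inj_on (\<lambda>c. {x \<in> pverts G. l x = c}) (l ` pverts G)" by (auto simp: inj_on_def)
  thus "image_mset card (mset_set P) = image_mset (\<lambda>c. card {x \<in> pverts G. l x = c}) (mset_set (l ` pverts G))"
    unfolding P_def by (subst image_mset_mset_set[symmetric]) (auto simp: image_mset.compositionality o_def)
qed

lemma card_residue_class:
  fixes p q :: nat and r :: int
  assumes "0 \<le> r" "r < int p"
  shows "card {x \<in> {0..<int (p * q)}. x mod int p = r} = q"
proof -
  have p: "int p > 0" using assms by linarith
  have "bij_betw (\<lambda>k. r + int p * k) {0..<int q} {x \<in> {0..<int (p * q)}. x mod int p = r}"
  proof (rule bij_betwI[of _ _ _ "\<lambda>x. x div int p"])
    show "(\<lambda>k. r + int p * k) \<in> {0..<int q} \<rightarrow> {x \<in> {0..<int (p * q)}. x mod int p = r}"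
    proof
      fix k assume k: "k \<in> {0..<int q}"
      have "int p * (k + 1) \<le> int p * int q" using k p by (intro mult_left_mono) auto
      hence "r + int p * k < int p * int q" using assms by (simp add: algebra_simps)
      thus "r + int p * k \<in> {x \<in> {0..<int (p * q)}. x mod int p = r}" using k assms by simp
    qed
    show "(\<lambda>x. x div int p) \<in> {x \<in> {0..<int (p * q)}. x mod int p = r} \<rightarrow> {0..<int q}"
    proof
      fix x assume x: "x \<in> {x \<in> {0..<int (p * q)}. x mod int p = r}"
      have "x div int p < int q"
      proof (rule ccontr)
        assume "\<not> x div int p < int q"
        hence "int p * int q \<le> int p * (x div int p)" using p by (intro mult_left_mono) auto
        also have "\<dots> \<le> x" using mult_div_mod_eq[of "int p" x] pos_mod_sign[OF p, of x] by linarith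
        finally show False using x by simp
      qed
      thus "x div int p \<in> {0..<int q}" using x p by (simp add: pos_imp_zdiv_nonneg_iff)
    qed
  qed (use assms p in \<open>auto simp: minus_mod_eq_mult_div [symmetric]\<close>)
  hence "card {x \<in> {0..<int (p * q)}. x mod int p = r} = card {0..<int q}" by (metis bij_betw_same_card)
  thus ?thesis by simp
qed

text \<open>Reduction modulo \<open>n\<close> keeps the gcd with \<open>n\<close>, and for
  \<open>m \<ge> 1\<close> being coprime to \<open>p^m\<close> means not being divisible by
  \<open>p\<close>.\<close>

lemma parcs_Cay_units_prime_power:
  fixes p m n :: nat
  assumes p: "prime p" and m: "m \<ge> 1" and n: "n = p ^ m"
    and S: "S = {a \<in> carrier (integer_mod_group n). gcd a (int n) = 1}"
  shows "(x, y) \<in> parcs (Cay (integer_mod_group n) S) \<longleftrightarrow>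
    x \<in> {0..<int n} \<and> y \<in> {0..<int n} \<and> x mod int p \<noteq> y mod int p"
proof -
  have n0: "n > 0" using p n by (simp add: prime_gt_0_nat)
  have carr: "carrier (integer_mod_group n) = {0..<int n}" using n0 by (simp add: carrier_integer_mod_group)
  have "inv\<^bsub>integer_mod_group n\<^esub> x \<otimes>\<^bsub>integer_mod_group n\<^esub> y \<in> S \<longleftrightarrow> x mod int p \<noteq> y mod int p"
    if x: "x \<in> {0..<int n}" and y: "y \<in> {0..<int n}"
  proof -
    have "inv\<^bsub>integer_mod_group n\<^esub> x = (- x) mod int n"
      using x carr by (simp add: inv_integer_mod_group)
    hence eq: "inv\<^bsub>integer_mod_group n\<^esub> x \<otimes>\<^bsub>integer_mod_group n\<^esub> y = (y - x) mod int n"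
      using n0 by (simp add: mod_simps)
    have "gcd ((y - x) mod int n) (int n) = 1 \<longleftrightarrow> coprime (y - x) (int n)"
      by (simp add: coprime_iff_gcd_eq_1 gcd.commute[of _ "int n"] flip: gcd_red_int)
    also have "\<dots> \<longleftrightarrow> coprime (y - x) (int p)"
      unfolding n using m by (simp add: coprime_power_right_iff)
    also have "\<dots> \<longleftrightarrow> \<not> int p dvd (y - x)"
      using p by (metis coprime_commute prime_imp_coprime prime_nat_int_transfer coprime_common_divisor dvd_refl not_prime_unit)
    also have "\<dots> \<longleftrightarrow> x mod int p \<noteq> y mod int p"
      by (metis mod_eq_dvd_iff)
    finally show ?thesis unfolding eq S carr using n0 by simp
  qed
  thus ?thesis unfolding Cay_def carr by auto
qed

lemma multicone_parts:
  fixes p m n v :: nat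
  assumes p: "prime p" and m: "m \<ge> 1" and n: "n = p ^ m"
    and S: "S = {a \<in> carrier (integer_mod_group n). gcd a (int n) = 1}"
  obtains P where "multipartite_parts (complete_graph v \<nabla> Cay (integer_mod_group n) S) P"
    "\<Union>P = pverts (complete_graph v \<nabla> Cay (integer_mod_group n) S)"
    "image_mset card (mset_set P) = replicate_mset v 1 + replicate_mset p (p ^ (m - 1))"
proof -
  define K where "K = complete_graph v \<nabla> Cay (integer_mod_group n) S"
  \<comment> \<open>Each vertex of the complete graph is its own label, and a vertex of the Cayley
    graph is labelled by its residue modulo \<open>p\<close>. Labels from the two summands always
    differ, which accounts for the edges of the join.\<close>
  define l :: "nat + int \<Rightarrow> nat + int" where "l = map_sum id (\<lambda>x. x mod int p)"
  have p0: "p > 0" and n0: "n > 0" using p n by (simp_all add: prime_gt_0_nat)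
  have nq: "n = p * p ^ (m - 1)" using m n by (cases m) auto
  have carr: "carrier (integer_mod_group n) = {0..<int n}" using n0 by (simp add: carrier_integer_mod_group)
  have V\<Gamma>: "pverts (Cay (integer_mod_group n) S) = {0..<int n}" by (simp add: Cay_def carr)
  hence V: "pverts K = {..<v} <+> {0..<int n}"
    by (simp add: K_def graph_join_def complete_graph_def)
  have fin: "finite (pverts K)" by (simp add: V)
  have arcs: "(x, y) \<in> parcs K \<longleftrightarrow> x \<in> pverts K \<and> y \<in> pverts K \<and> l x \<noteq> l y" for x y
    unfolding V
    by (cases x; cases y)
       (auto simp: K_def graph_join_def complete_graph_def parcs_Cay_units_prime_power[OF assms] l_def V\<Gamma>)
  note parts = multipartite_parts_labelling[OF fin arcs]
  have lV: "l ` pverts K = Inl ` {..<v} \<union> Inr ` {0..<int p}"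
  proof -
    have "(\<lambda>x. x mod int p) ` {0..<int n} = {0..<int p}"
    proof (intro equalityI subsetI)
      fix r assume r: "r \<in> {0..<int p}"
      \<comment> \<open>Each residue is attained by its least representative, which lies below
        \<open>p\<close> and hence below \<open>n\<close>.\<close>
      have "int p \<le> int n" unfolding nq using p0 by simp
      with r have "r \<in> {0..<int n}" "r = r mod int p" by auto
      thus "r \<in> (\<lambda>x. x mod int p) ` {0..<int n}" by blast
    qed (use p0 in auto)
    moreover have "l ` Inl ` {..<v} = Inl ` {..<v}" by (simp add: image_image l_def)
    moreover have "l ` Inr ` {0..<int n} = Inr ` (\<lambda>x. x mod int p) ` {0..<int n}"
      by (simp add: image_image l_def)
    ultimately show ?thesis by (simp only: V Plus_def image_Un)
  qed
  have c1: "card {x \<in> pverts K. l x = Inl i} = 1" if "i < v" for i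
  proof -
    have "{x \<in> pverts K. l x = Inl i} = {Inl i}" using that by (auto simp: V l_def)
    thus ?thesis by simp
  qed
  have c2: "card {x \<in> pverts K. l x = Inr r} = p ^ (m - 1)" if "r \<in> {0..<int p}" for r
  proof -
    have "{x \<in> pverts K. l x = Inr r} = Inr ` {x \<in> {0..<int n}. x mod int p = r}"
      by (auto simp: V l_def)
    thus ?thesis using card_residue_class[of r p "p ^ (m - 1)"] that
      by (simp add: card_image nq)
  qed
  have "image_mset (\<lambda>c. card {x \<in> pverts K. l x = c}) (mset_set (l ` pverts K)) =
      image_mset (\<lambda>i. card {x \<in> pverts K. l x = Inl i}) (mset_set {..<v}) +
      image_mset (\<lambda>r. card {x \<in> pverts K. l x = Inr r}) (mset_set {0..<int p})"
    unfolding lV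
    by (subst mset_set_Union) (auto simp: image_mset.compositionality o_def simp flip: image_mset_mset_set)
  also have "image_mset (\<lambda>i. card {x \<in> pverts K. l x = Inl i}) (mset_set {..<v}) = replicate_mset v 1"
    using c1 by (subst image_mset_cong[of _ _ "\<lambda>_. 1"]) (auto simp: image_mset_const_eq)
  also have "image_mset (\<lambda>r. card {x \<in> pverts K. l x = Inr r}) (mset_set {0..<int p}) = replicate_mset p (p ^ (m - 1))"
    using c2 by (subst image_mset_cong[of _ _ "\<lambda>_. p ^ (m - 1)"]) (auto simp: image_mset_const_eq)
  finally show ?thesis using that[folded K_def, OF parts(1,2)] parts(3) by (simp only:)
qed

section \<open>Recovering the graph from its spectrum\<close>

text \<open>A complex characteristic polynomial is monic and splits, so it is determined by its
  roots with multiplicity, and their number is the dimension.\<close>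

lemma char_poly_eq_if_proots_eq:
  fixes A B :: "complex mat"
  assumes A: "A \<in> carrier_mat n n" and B: "B \<in> carrier_mat k k" and eq: "proots (char_poly A) = proots (char_poly B)"
  shows "char_poly A = char_poly B" "n = k"
proof -
  have *: "char_poly C = (\<Prod>a\<in>#proots (char_poly C). [:- a, 1:]) \<and> size (proots (char_poly C)) = j"
    if C: "C \<in> carrier_mat j j" for C :: "complex mat" and j
  proof -
    obtain as where as: "char_poly C = (\<Prod>a\<leftarrow>as. [:- a, 1:])" "length as = j"
      using char_poly_factorized[OF C] by blast
    have "proots (\<Prod>a\<leftarrow>as. [:- a, 1:]) = mset as" for as :: "complex list"
    proof (induction as)
      case (Cons a as)
      have "(\<Prod>a\<leftarrow>as. [:- a, 1:]) \<noteq> (0 :: complex poly)" by (auto simp: prod_list_zero_iff)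
      with Cons show ?case by (simp add: proots_mult del: mult_pCons_left)
    qed simp
    hence "proots (char_poly C) = mset as" by (simp add: as)
    thus ?thesis using as by (simp add: prod_mset_prod_list flip: mset_map)
  qed
  show "char_poly A = char_poly B" "n = k" using *[OF A] *[OF B] eq by metis+
qed

lemma card_Union_multipartite:
  assumes "multipartite_parts G P"
  shows "card (\<Union>P) = sum_mset (image_mset card (mset_set P))"
proof -
  note PD = multipartite_partsD[OF assms]
  have "card (\<Union>P) = (\<Sum>X\<in>P. card X)"
    using PD(3,5) by (intro card_Union_disjoint) (auto simp: disjoint_def pairwise_def disjnt_def)
  thus ?thesis by (simp add: sum_unfold_sum_mset)
qed

theorem theorem3p3:
  fixes p m n v :: nat and S :: "int set" and \<Gamma> :: "int pair_pre_digraph"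
  assumes "prime p" and "m \<ge> 1" and "n = p ^ m"
    and "S = {a \<in> carrier (integer_mod_group n). gcd a (int n) = 1}"
    and "\<Gamma> = Cay (integer_mod_group n) S"
    and "v \<ge> 1"
  shows "determined_by_spectrum TYPE('b) (complete_graph v \<nabla> \<Gamma>)"
  unfolding determined_by_spectrum_def
proof (intro allI impI)
  fix H :: "'b pair_pre_digraph"
  define K where "K = complete_graph v \<nabla> \<Gamma>"
  assume H: "pair_graph H" and "adjacency_spectrum H = adjacency_spectrum (complete_graph v \<nabla> \<Gamma>)"
  hence spec: "adjacency_spectrum H = adjacency_spectrum K" by (simp add: K_def)
  define L where "L = replicate_mset v 1 + replicate_mset p (p ^ (m - 1))"
  obtain P where P: "multipartite_parts K P" "\<Union>P = pverts K" "image_mset card (mset_set P) = L"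
    using multicone_parts[OF assms(1-4), of v] unfolding K_def assms(5) L_def by blast
  \<comment> \<open>Having at most one positive eigenvalue is read off from the spectrum, so it
    passes from \<open>K\<close> to \<open>H\<close>.\<close>
  obtain Q where Q: "multipartite_parts H Q" "card Q \<noteq> 1"
    using multipartite_parts_if_one_positive_eigenvalue[OF H]
      multipartite_one_positive_eigenvalue[OF P(1)] unfolding spec by blast
  note PD = multipartite_partsD[OF P(1)] and QD = multipartite_partsD[OF Q(1)]
  define M where "M = image_mset card (mset_set Q)"
  obtain vs where vs: "distinct vs" "set vs = pverts K" using finite_distinct_list[OF PD(1)] by blast
  obtain ws where ws: "distinct ws" "set ws = pverts H" using finite_distinct_list[OF QD(1)] by blast
  have "proots (char_poly (adjacency_matrix H ws)) = proots (char_poly (adjacency_matrix K vs))"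
    using spec by (simp add: adjacency_spectrum_eq[OF vs] adjacency_spectrum_eq[OF ws])
  from char_poly_eq_if_proots_eq[OF _ _ this, of "length ws" "length vs"]
  have cp: "char_poly (adjacency_matrix H ws) = char_poly (adjacency_matrix K vs)" and "length ws = length vs"
    by (auto simp: adjacency_matrix_def)
  hence cardV: "card (pverts H) = card (pverts K)" using vs ws by (metis distinct_card)
  have p2: "p \<ge> 2" using assms(1) by (rule prime_ge_2_nat)
  have sizes: "size M = card Q" "size L = card P" "size L = v + p"
    using arg_cong[OF P(3), of size] by (auto simp: M_def L_def)
  have M0: "0 \<notin># M" using QD(2-4) by (auto simp: M_def card_eq_0_iff)
  have L0: "0 \<notin># L" using p2 by (auto simp: L_def)
  have e1: "monom 1 (size M) * char_poly (adjacency_matrix K vs) = monom 1 (card (pverts K)) * multipartite_poly M"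
    using char_poly_multipartite[OF Q(1) ws] by (simp add: sizes cp cardV M_def)
  have e2: "monom 1 (size L) * char_poly (adjacency_matrix K vs) = monom 1 (card (pverts K)) * multipartite_poly L"
    using char_poly_multipartite[OF P(1) vs] by (simp add: sizes(2) P(3))
  have "size M = size L" "multipartite_poly M = multipartite_poly L"
    using multipartite_poly_size_eq[OF e1 e2 M0 _ L0] Q(2) p2 sizes by auto
  hence parts_eq: "M = L"
    using multipartite_poly_determines_parts[OF assms(1) refl assms(6), of M "m - 1"] M0 sizes
    unfolding L_def by simp
  \<comment> \<open>The parts of \<open>H\<close> cover as many vertices as those of
    \<open>K\<close>, which are all of them, and both graphs have equally many vertices. Hence
    \<open>H\<close> has no vertex outside its parts.\<close>
  have "card (\<Union>Q) = card (pverts H)"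
    using card_Union_multipartite[OF Q(1)] card_Union_multipartite[OF P(1)] parts_eq by (simp add: M_def P(2,3) cardV)
  hence "\<Union>Q = pverts H" using QD(1,6) by (intro card_subset_eq)
  with Q(1) P parts_eq show "digraph_iso (with_proj H) (with_proj (complete_graph v \<nabla> \<Gamma>))"
    unfolding K_def[symmetric] by (intro multipartite_digraph_iso[of H Q K P]) (auto simp: M_def)
qed

end
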